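(* For every $n\ge 2$, the twin peaks graph $TP_{n+1}$, obtained by removing the edge between $1$ and $n+1$ from the complete graph $K_{n+1}$ with vertex set $\{1,\dots,n+1\}$, is appendable $(e)$-positive.
   Context: All graphs are finite and simple with nonempty vertex set. A labelled graph on $d$ vertices is a graph with vertex set $[d]=\{1,\dots,d\}$. For a set partition $\pi$ of $[d]$, let $B_{\pi,i}$ be the block containing $i$, and let $e_\pi=\sum x_{i_1}\cdots x_{i_d}$ in noncommuting variables $x_1,x_2,\dots$, summed over all tuples $(i_1,\dots,i_d)$ of positive integers with $i_j\ne i_k$ whenever $j\neq k$ and $B_{\pi,j}=B_{\pi,k}$. The $e_\pi$, over set partitions $\pi$ of $[d]$, form a $\mathbb Q$-basis of $\mathrm{NCSym}^d$, the degree-$d$ part of the algebra of symmetric functions in noncommuting variables. For $d\ge 1$ let $\mathrm{type}(\pi)=(\lambda,b)$, where $b=|B_{\pi,d}|$ and $\lambda$ is the integer partition (possibly empty) formed by the sizes of the other blocks. $\mathrm{UBCSym}^d$ is the $\mathbb Q$-vector space with basis $\{e_{(\lambda,b)}\}$ over pairs of a partition $\lambda$ and an integer $b\ge 1$ with $|\lambda|+b=d$, and $\nu:\mathrm{NCSym}^d\to\mathrm{UBCSym}^d$ is the linear map with $\nu(e_\pi)=e_{\mathrm{type}(\pi)}$. For a labelled graph $G$ on $d$ vertices, $Y_G=\sum_\kappa x_{\kappa(1)}\cdots x_{\kappa(d)}\in\mathrm{NCSym}^d$, summed over all proper colourings $\kappa:[d]\to\mathbb Z_{>0}$ of $G$,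 and $y_G=\nu(Y_G)$. $G$ is $(e)$-positive if all coefficients of $y_G$ in the basis $\{e_{(\lambda,b)}\}$ are nonnegative. For labelled graphs $G$ on $n$ vertices and $H$ on $m$ vertices, the concatenation $G+H$ is the labelled graph on $[n+m-1]$ obtained by placing $G$ on labels $1,\dots,n$ and $H$ on labels $n,\dots,n+m-1$ (vertex $i$ of $H$ becoming $n-1+i$), so vertex $n$ of $G$ is identified with vertex $1$ of $H$. A labelled graph $H$ is appendable $(e)$-positive if $G+H$ is $(e)$-positive for every $(e)$-positive labelled graph $G$. *)

theory Defs
  imports Complex_Main "HOL-Library.Multiset" "HOL-Library.FuncSet" "HOL-Library.Disjoint_Sets"
    "HOL-Library.Function_Algebras" "HOL-Library.Poly_Mapping"
begin

definition complete_graph :: "nat \<Rightarrow> nat set set" where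
  "complete_graph d = {{i, j} | i j. i \<in> {1..d} \<and> j \<in> {1..d} \<and> i \<noteq> j}"

definition labelled_graph :: "nat \<Rightarrow> nat set set \<Rightarrow> bool" where
  "labelled_graph d E \<longleftrightarrow> d \<ge> 1 \<and> E \<subseteq> complete_graph d"

definition twin_peaks :: "nat \<Rightarrow> nat set set" where
  "twin_peaks d = complete_graph d - {{1, d}}"

text \<open>Edges of \<open>G + H\<close>, where \<open>G\<close> has \<open>n\<close> vertices and edge set \<open>E\<close>, and \<open>F\<close> is the edge set
  of \<open>H\<close>; the number \<open>m\<close> of vertices of \<open>H\<close> only enters the vertex set \<open>{1..n + m - 1}\<close>.\<close>

definition concatenation :: "nat \<Rightarrow> nat set set \<Rightarrow> nat set set \<Rightarrow> nat set set" where
  "concatenation n E F = E \<union> (\<lambda>e. (\<lambda>i. n - 1 + i) ` e) ` F"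

text \<open>A formal power series in noncommuting variables \<open>x\<^sub>1, x\<^sub>2, \<dots>\<close> is given by its
  coefficients: the word \<open>[i\<^sub>1, \<dots>, i\<^sub>d]\<close> stands for the monomial \<open>x\<^bsub>i\<^sub>1\<^esub> \<cdots> x\<^bsub>i\<^sub>d\<^esub>\<close>.
  The vector space structure is pointwise.\<close>

type_synonym ncseries = "nat list \<Rightarrow> rat"

definition ncscale :: "rat \<Rightarrow> ncseries \<Rightarrow> ncseries" where
  "ncscale c f = (\<lambda>w. c * f w)"

global_interpretation nc: vector_space ncscale
  by unfold_locales (auto simp: ncscale_def fun_eq_iff algebra_simps)

definition tuples :: "nat \<Rightarrow> (nat \<Rightarrow> nat) set" where
  "tuples d = {1..d} \<rightarrow>\<^sub>E {1..}"

text \<open>The formal sum of \<open>x\<^bsub>\<kappa>(1)\<^esub> \<cdots> x\<^bsub>\<kappa>(d)\<^esub>\<close> over all \<open>\<kappa> \<in> K\<close>.  Each word arises from at most one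
  \<open>\<kappa> \<in> tuples d\<close>, so the cardinality below is finite for \<open>K \<subseteq> tuples d\<close>.\<close>

definition monomial_sum :: "nat \<Rightarrow> (nat \<Rightarrow> nat) set \<Rightarrow> ncseries" where
  "monomial_sum d K = (\<lambda>w. of_nat (card {\<kappa> \<in> K. map \<kappa> [1..<d + 1] = w}))"

definition block :: "nat set set \<Rightarrow> nat \<Rightarrow> nat set" where
  "block \<pi> i = (THE B. B \<in> \<pi> \<and> i \<in> B)"

definition set_partitions :: "nat \<Rightarrow> nat set set set" where
  "set_partitions d = {\<pi>. partition_on {1..d} \<pi>}"

definition nc_e :: "nat \<Rightarrow> nat set set \<Rightarrow> ncseries" where
  "nc_e d \<pi> = monomial_sum d
     {\<kappa> \<in> tuples d. \<forall>j\<in>{1..d}. \<forall>k\<in>{1..d}. j \<noteq> k \<and> block \<pi> j = block \<pi> k \<longrightarrow> \<kappa> j \<noteq> \<kappa> k}"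

definition chromatic_Y :: "nat \<Rightarrow> nat set set \<Rightarrow> ncseries" where
  "chromatic_Y d E = monomial_sum d
     {\<kappa> \<in> tuples d. \<forall>i j. {i, j} \<in> E \<longrightarrow> \<kappa> i \<noteq> \<kappa> j}"

definition partition_type :: "nat \<Rightarrow> nat set set \<Rightarrow> nat multiset \<times> nat" where
  "partition_type d \<pi> =
     (image_mset card (mset_set (\<pi> - {block \<pi> d})), card (block \<pi> d))"

definition ub_index :: "nat \<Rightarrow> (nat multiset \<times> nat) set" where
  "ub_index d = {(l, b). 0 \<notin># l \<and> b \<ge> 1 \<and> sum_mset l + b = d}"

text \<open>\<open>UBCSym\<^sup>d\<close> consists of the finitely supported rational functions with support in
  \<open>ub_index d\<close>; \<open>Poly_Mapping.single t c\<close> is \<open>c\<close> times the basis vector \<open>e\<^sub>t\<close>.  The family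
  \<open>nc_e d \<pi>\<close>, with \<open>\<pi>\<close> ranging over \<open>set_partitions d\<close>, is a basis of \<open>NCSym\<^sup>d\<close> (indexed without
  repetition), so that on \<open>NCSym\<^sup>d\<close> the following is the linear map sending \<open>nc_e d \<pi>\<close> to the
  basis vector at \<open>partition_type d \<pi>\<close>.\<close>

definition nu :: "nat \<Rightarrow> ncseries \<Rightarrow> (nat multiset \<times> nat) \<Rightarrow>\<^sub>0 rat" where
  "nu d f = (\<Sum>\<pi>\<in>set_partitions d.
     Poly_Mapping.single (partition_type d \<pi>)
       (nc.representation (nc_e d ` set_partitions d) f (nc_e d \<pi>)))"

definition chromatic_y :: "nat \<Rightarrow> nat set set \<Rightarrow> (nat multiset \<times> nat) \<Rightarrow>\<^sub>0 rat" where
  "chromatic_y d E = nu d (chromatic_Y d E)"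

definition e_positive :: "nat \<Rightarrow> nat set set \<Rightarrow> bool" where
  "e_positive d E \<longleftrightarrow> labelled_graph d E \<and>
     (\<forall>t\<in>ub_index d. Poly_Mapping.lookup (chromatic_y d E) t \<ge> 0)"

definition appendable_e_positive :: "nat \<Rightarrow> nat set set \<Rightarrow> bool" where
  "appendable_e_positive m F \<longleftrightarrow> labelled_graph m F \<and>
     (\<forall>n E. e_positive n E \<longrightarrow> e_positive (n + m - 1) (concatenation n E F))"

end

theory Submission
  imports Defs
begin

text \<open>Appending a fixed graph multiplies the coefficient of each word, so it acts linearly on
  \<open>Y\<^sub>G = (\<Sum>\<pi>. c\<^sub>\<pi> e\<^sub>\<pi>)\<close>, and it suffices to treat disjoint unions of cliques.  The blocks not containing
  the gluing vertex are spectators.  For the remaining clique of size \<open>a + 1\<close>, \<open>\<nu>\<close> does not see how the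
  graph is placed on its vertices as long as the last vertex \<open>d\<close> stays fixed, so one may sum over all
  placements on \<open>S \<union> {d}\<close>, where \<open>|S| = a + n\<close>.  This sum equals
  \<open>(\<Sum>L\<subseteq>S. x\<^bsub>|L|\<^esub> e(L \<union> {d} | S - L))\<close> with \<open>x\<^sub>l = [l \<le> a] (a + 1 - l) + [l \<ge> n] (l - a - 1) \<ge> 0\<close>.
  The identity is checked coefficientwise: for a colouring \<open>\<kappa>\<close> one counts the bisections of \<open>S\<close> on
  whose two sides \<open>\<kappa>\<close> is injective.\<close>

section \<open>Counting bisections\<close>

text \<open>Positivity fails before \<nu> is applied: for the path 1-2-3, which is
  \<open>twin_peaks 3\<close>, Y is half of e(12|3) + e(1|23) - e(13|2) + e(123). The negative term
  disappears only because \<nu> identifies e(1|23) with e(13|2); summing over placements turns such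
  cancellations into an identity of series. The coefficients of Y_G may be negative too, but the
  outcome of appending depends on a partition only through its type, so that only the coefficients
  of y_G enter. The numbers x_l come from telescoping. A vertex whose colour is absent from the
  other side of a bisection can change sides. Counting these moves from either end gives h_l -
  h_(l-1) = (a + n - 2l) b_l, where b_l counts bisections with first side of size l and h_l the
  moves from size l to l + 1. When the colour of d is new, h_a is the number of proper placements.
  Since \<open>nc.representation\<close> is 0 for a dependent family, the e_\<pi> must first be
  shown independent; this is a dimension count against the monomial basis.\<close>

definition bisections :: "('a \<Rightarrow> 'b) \<Rightarrow> 'a set \<Rightarrow> nat \<Rightarrow> 'a set set" where
  "bisections \<kappa> S l = {L. L \<subseteq> S \<and> card L = l \<and> inj_on \<kappa> L \<and> inj_on \<kappa> (S - L)}"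

text \<open>Gluing \<open>K\<^bsub>a+1\<^esub>\<close> and \<open>TP\<^bsub>n+1\<^esub>\<close> at \<open>v\<close> gives the cliques \<open>insert v A\<close>, \<open>S - A\<close> and
  \<open>insert d (S - A - {v})\<close>, where \<open>d\<close> is the last vertex and \<open>S\<close> holds all the others.  The set \<open>peaks\<close>
  collects the ways to place this graph on \<open>insert d S\<close> so that \<open>\<kappa>\<close> is proper; \<open>hinges\<close> ignores \<open>d\<close>.\<close>

definition hinges :: "('a \<Rightarrow> 'b) \<Rightarrow> 'a set \<Rightarrow> nat \<Rightarrow> ('a set \<times> 'a) set" where
  "hinges \<kappa> S l = {(A, v). v \<in> S \<and> A \<subseteq> S - {v} \<and> card A = l \<and>
     inj_on \<kappa> (insert v A) \<and> inj_on \<kappa> (S - A)}"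

definition peaks :: "('a \<Rightarrow> 'b) \<Rightarrow> 'a set \<Rightarrow> 'a \<Rightarrow> nat \<Rightarrow> ('a set \<times> 'a) set" where
  "peaks \<kappa> S d a = {(A, v). v \<in> S \<and> A \<subseteq> S - {v} \<and> card A = a \<and>
     inj_on \<kappa> (insert v A) \<and> inj_on \<kappa> (S - A) \<and> inj_on \<kappa> (insert d (S - A - {v}))}"

text \<open>A summand \<open>l\<close> and its mirror image \<open>N - l\<close> under exchanging the two sides of a bisection
  naturally carry the weights \<open>a + 1 - l\<close> and \<open>n - 1 - l\<close> for \<open>l \<le> a\<close>, where \<open>N = a + n\<close>; the latter
  can be negative.  Collected at the same \<open>l\<close>, the negative parts cancel.\<close>

definition weight :: "nat \<Rightarrow> nat \<Rightarrow> nat \<Rightarrow> int" where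
  "weight a n l = (if l \<le> a then int a + 1 - int l else 0) + (if n \<le> l then int l - int a - 1 else 0)"

lemma weight_nonneg: "weight a n l \<ge> 0"
  by (auto simp: weight_def)

lemma finite_bisections: "finite S \<Longrightarrow> finite (bisections \<kappa> S l)"
  by (rule finite_subset[of _ "Pow S"]) (auto simp: bisections_def)

text \<open>Here v still lies opposite A, and \<open>insert v A\<close> is injective exactly when
  the colour of v is absent from A. With the count taken after v has crossed over, this is a double
  count linking sizes l and l + 1.\<close>

lemma card_hinges:
  assumes "finite S"
  shows "card (hinges \<kappa> S l) = (\<Sum>L\<in>bisections \<kappa> S l. card {v \<in> S - L. \<kappa> v \<notin> \<kappa> ` L})"
proof -
  have "hinges \<kappa> S l = (SIGMA L:bisections \<kappa> S l. {v \<in> S - L. \<kappa> v \<notin> \<kappa> ` L})"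
    unfolding hinges_def bisections_def by (auto simp: inj_on_insert)
  with assms show ?thesis
    by (simp add: finite_bisections)
qed

text \<open>The same hinges after the move: L is \<open>insert v A\<close>, of size l + 1, and the
  condition on v now says that it could move back.\<close>

lemma card_hinges':
  assumes "finite S"
  shows "card (hinges \<kappa> S l) = (\<Sum>L\<in>bisections \<kappa> S (Suc l). card {v \<in> L. \<kappa> v \<notin> \<kappa> ` (S - L)})"
proof -
  let ?T = "SIGMA L:bisections \<kappa> S (Suc l). {v \<in> L. \<kappa> v \<notin> \<kappa> ` (S - L)}"
  have sub: "A \<subseteq> S \<Longrightarrow> finite A" for A
    using assms finite_subset by blast
  have "bij_betw (\<lambda>(A, v). (insert v A, v)) (hinges \<kappa> S l) ?T"
  proof (rule bij_betwI[where g = "\<lambda>(L, v). (L - {v}, v)"])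
    show "(\<lambda>(A, v). (insert v A, v)) \<in> hinges \<kappa> S l \<rightarrow> ?T"
    proof (rule funcsetI)
      fix p assume "p \<in> hinges \<kappa> S l"
      then obtain A v where p: "p = (A, v)" and *: "(A, v) \<in> hinges \<kappa> S l"
        by (cases p) auto
      then have "v \<in> S - A" "inj_on \<kappa> (S - A)"
        by (auto simp: hinges_def)
      then have "\<kappa> v \<notin> \<kappa> ` (S - A - {v})" "inj_on \<kappa> (S - A - {v})"
        by (auto simp: inj_on_def)
      moreover have "S - insert v A = S - A - {v}" by auto
      ultimately show "(case p of (A, v) \<Rightarrow> (insert v A, v)) \<in> ?T"
        using * p by (auto simp: hinges_def bisections_def card_insert_if sub subset_Diff_insert)
    qed
    show "(\<lambda>(L, v). (L - {v}, v)) \<in> ?T \<rightarrow> hinges \<kappa> S l"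
    proof (rule funcsetI)
      fix p assume "p \<in> ?T"
      then obtain L v where p: "p = (L, v)"
        and *: "L \<in> bisections \<kappa> S (Suc l)" "v \<in> L" "\<kappa> v \<notin> \<kappa> ` (S - L)"
        by (cases p) auto
      then have eq: "S - (L - {v}) = insert v (S - L)" "insert v (L - {v}) = L"
        by (auto simp: bisections_def)
      have "v \<in> S" "L - {v} \<subseteq> S - {v}" "card (L - {v}) = l" "inj_on \<kappa> L" "inj_on \<kappa> (insert v (S - L))"
        using * by (auto simp: bisections_def inj_on_insert)
      then show "(case p of (L, v) \<Rightarrow> (L - {v}, v)) \<in> hinges \<kappa> S l"
        unfolding hinges_def p by (simp only: mem_Collect_eq prod.case eq simp_thms)
    qed
  qed (auto simp: hinges_def)
  then have "card (hinges \<kappa> S l) = card ?T"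
    by (rule bij_betw_same_card)
  also have "\<dots> = (\<Sum>L\<in>bisections \<kappa> S (Suc l). card {v \<in> L. \<kappa> v \<notin> \<kappa> ` (S - L)})"
    using assms by (intro card_SigmaI finite_bisections ballI)
      (auto simp: bisections_def intro: sub)
  finally show ?thesis .
qed

text \<open>The colours used on both sides of a bisection are counted once on either side, so they cancel.\<close>

lemma card_unmatched_diff:
  assumes "finite S" and "L \<in> bisections \<kappa> S l"
  shows "int (card {v \<in> S - L. \<kappa> v \<notin> \<kappa> ` L}) - int (card {v \<in> L. \<kappa> v \<notin> \<kappa> ` (S - L)}) =
    int (card S) - 2 * int l"
proof -
  have L: "L \<subseteq> S" "card L = l" "inj_on \<kappa> L" "inj_on \<kappa> (S - L)" "finite L"
    using assms finite_subset by (auto simp: bisections_def)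
  have matched: "int (card {v \<in> A. \<kappa> v \<notin> B}) = int (card A) - int (card (\<kappa> ` A \<inter> B))"
    if "finite A" "inj_on \<kappa> A" for A B
  proof -
    have "card A = card {v \<in> A. \<kappa> v \<notin> B} + card {v \<in> A. \<kappa> v \<in> B}"
      using that(1) by (subst card_Un_disjoint[symmetric]) (auto intro!: arg_cong[where f = card])
    moreover have "card {v \<in> A. \<kappa> v \<in> B} = card (\<kappa> ` {v \<in> A. \<kappa> v \<in> B})"
      by (rule card_image[symmetric]) (use that(2) in \<open>auto simp: inj_on_def\<close>)
    moreover have "\<kappa> ` {v \<in> A. \<kappa> v \<in> B} = \<kappa> ` A \<inter> B" by auto
    ultimately show ?thesis by simp
  qed
  have "card (S - L) + l = card S"
    using L assms(1) by (metis card_Diff_subset card_mono le_add_diff_inverse2)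
  then show ?thesis
    using matched[of "S - L" "\<kappa> ` L"] matched[of L "\<kappa> ` (S - L)"] L assms(1)
    by (simp add: Int_commute)
qed

text \<open>The sum telescopes: by the two counts of hinges, each summand is the number of hinges at
  l minus the number at l - 1.\<close>

lemma sum_card_bisections:
  assumes "finite S"
  shows "(\<Sum>l\<le>a. (int (card S) - 2 * int l) * int (card (bisections \<kappa> S l))) = int (card (hinges \<kappa> S a))"
proof -
  have diff: "(int (card S) - 2 * int l) * int (card (bisections \<kappa> S l)) =
      int (card (hinges \<kappa> S l)) - (\<Sum>L\<in>bisections \<kappa> S l. int (card {v \<in> L. \<kappa> v \<notin> \<kappa> ` (S - L)}))" for l
  proof -
    have "(int (card S) - 2 * int l) * int (card (bisections \<kappa> S l)) =
      (\<Sum>L\<in>bisections \<kappa> S l. int (card {v \<in> S - L. \<kappa> v \<notin> \<kappa> ` L}) - int (card {v \<in> L. \<kappa> v \<notin> \<kappa> ` (S - L)}))"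
      by (simp only: card_unmatched_diff[OF assms] sum_constant cong: sum.cong) (simp add: mult.commute)
    then show ?thesis
      by (simp add: card_hinges[OF assms] sum_subtractf)
  qed
  show ?thesis
  proof (induction a)
    case 0
    \<comment> \<open>At l = 0 the side L is empty, so no hinge arrives from below.\<close>
    have "(\<Sum>L\<in>bisections \<kappa> S 0. int (card {v \<in> L. \<kappa> v \<notin> \<kappa> ` (S - L)})) = 0"
      using assms by (intro sum.neutral) (auto simp: bisections_def card_eq_0_iff dest: finite_subset)
    with diff[of 0] show ?case by simp
  next
    case (Suc a)
    then show ?case
      using diff[of "Suc a"] by (simp add: card_hinges'[OF assms, of \<kappa> a])
  qed
qed

lemma card_bisections_complement:
  assumes "finite S" and "l \<le> card S"
  shows "card (bisections \<kappa> S (card S - l)) = card (bisections \<kappa> S l)"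
proof (rule bij_betw_same_card)
  show "bij_betw (\<lambda>L. S - L) (bisections \<kappa> S (card S - l)) (bisections \<kappa> S l)"
    by (rule bij_betwI[where g = "\<lambda>L. S - L"])
      (use assms in \<open>auto simp: bisections_def card_Diff_subset finite_subset double_diff\<close>)
qed

lemma card_bisections_eq_0:
  assumes "finite S" and "card S < l"
  shows "card (bisections \<kappa> S l) = 0"
proof -
  have "bisections \<kappa> S l = {}"
    using assms card_mono[of S] by (auto simp: bisections_def not_le[symmetric])
  then show ?thesis by simp
qed

section \<open>Weighted counts of bisections and of placements\<close>

lemma sum_Pow_bisections:
  assumes "finite S"
  shows "(\<Sum>L\<in>Pow S. f (card L) * of_bool (inj_on \<kappa> L \<and> inj_on \<kappa> (S - L))) =
    (\<Sum>l\<le>card S. f l * int (card (bisections \<kappa> S l)))"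
proof -
  let ?X = "{L \<in> Pow S. inj_on \<kappa> L \<and> inj_on \<kappa> (S - L)}"
  have "(\<Sum>L\<in>Pow S. f (card L) * of_bool (inj_on \<kappa> L \<and> inj_on \<kappa> (S - L))) = (\<Sum>L\<in>?X. f (card L))"
    using assms by (intro sum.mono_neutral_cong_right) auto
  also have "\<dots> = (\<Sum>l\<le>card S. \<Sum>L\<in>{L \<in> ?X. card L = l}. f (card L))"
    using assms by (intro sum.group[symmetric]) (auto intro: card_mono)
  also have "\<dots> = (\<Sum>l\<le>card S. f l * int (card (bisections \<kappa> S l)))"
  proof (rule sum.cong[OF refl])
    fix l
    have "{L \<in> ?X. card L = l} = bisections \<kappa> S l" by (auto simp: bisections_def)
    then show "(\<Sum>L\<in>{L \<in> ?X. card L = l}. f (card L)) = f l * int (card (bisections \<kappa> S l))"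
      by (simp add: bisections_def)
  qed
  finally show ?thesis .
qed

text \<open>Reflecting l to M - l turns the part of \<open>weight\<close> supported on n \<le> l
  into the second sum on the right. The sequence c stands for the numbers of bisections of a set of
  size M: j = 0 if this set is S, j = 1 if a vertex sharing the colour of d has been taken
  out.\<close>

lemma sum_weight_symmetric:
  fixes c :: "nat \<Rightarrow> int"
  assumes sym: "\<And>l. l \<le> M \<Longrightarrow> c (M - l) = c l" and zero: "\<And>l. M < l \<Longrightarrow> c l = 0" and "a + n = M + j"
    and "n \<ge> 1" and "j \<le> 1"
  shows "(\<Sum>l\<le>M. weight a n l * c l) =
    (\<Sum>l\<le>a. (int a + 1 - int l) * c l) + (\<Sum>l<a + 1 - j. (int n - int j - 1 - int l) * c l)"
proof -
  have "(\<Sum>l\<le>M. weight a n l * c l) = (\<Sum>l\<le>M. if l \<le> a then (int a + 1 - int l) * c l else 0)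
      + (\<Sum>l\<le>M. if n \<le> l then (int l - int a - 1) * c l else 0)"
    unfolding sum.distrib[symmetric] by (intro sum.cong) (auto simp: weight_def algebra_simps)
  also have "(\<Sum>l\<le>M. if l \<le> a then (int a + 1 - int l) * c l else 0) = (\<Sum>l\<le>a. (int a + 1 - int l) * c l)"
    by (rule sum.mono_neutral_cong) (auto simp: zero not_le)
  also have "(\<Sum>l\<le>M. if n \<le> l then (int l - int a - 1) * c l else 0) =
      (\<Sum>l\<le>M. if n \<le> M - l then (int (M - l) - int a - 1) * c (M - l) else 0)"
    by (rule sum.reindex_bij_witness[of _ "\<lambda>l. M - l" "\<lambda>l. M - l"]) auto
  also have "\<dots> = (\<Sum>l<a + 1 - j. (int n - int j - 1 - int l) * c l)"
  proof (rule sum.mono_neutral_cong)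
    \<comment> \<open>Here l exceeds a - j, that is, M - l < n. For a = 0 and j = 1 the upper end a
      + 1 - j is 0 and every l falls into this case.\<close>
    fix l assume "l \<in> {..M} - {..<a + 1 - j}"
    then show "(if n \<le> M - l then (int (M - l) - int a - 1) * c (M - l) else 0) = 0"
      using assms by (cases "a + 1 - j") auto
  qed (use assms in \<open>auto simp: sym of_nat_diff\<close>)
  finally show ?thesis .
qed


text \<open>If no vertex of S has the colour of d, the clique through d imposes nothing beyond
  injectivity on \<open>S - A\<close>, so placements are hinges and the telescoped sum counts
  them.\<close>

lemma card_peaks_unmatched:
  assumes S: "finite S" "d \<notin> S" "card S = a + n" "n \<ge> 1" and d: "\<kappa> d \<notin> \<kappa> ` S"
  shows "int (card (peaks \<kappa> S d a)) =
    (\<Sum>L\<in>Pow S. weight a n (card L) * of_bool (inj_on \<kappa> (insert d L) \<and> inj_on \<kappa> (S - L)))"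
proof -
  have ins: "inj_on \<kappa> (insert d L) \<longleftrightarrow> inj_on \<kappa> L" if "L \<subseteq> S" for L
    using that d S(2) by (auto simp: inj_on_insert)
  have "peaks \<kappa> S d a = hinges \<kappa> S a"
    unfolding peaks_def hinges_def
  proof (intro Collect_cong prod.case_cong refl)
    fix A v
    have "S - A - {v} \<subseteq> S" by auto
    note ins[OF this]
    moreover have "inj_on \<kappa> (S - A - {v})" if "inj_on \<kappa> (S - A)"
      using that by (rule inj_on_subset) auto
    ultimately show "(v \<in> S \<and> A \<subseteq> S - {v} \<and> card A = a \<and> inj_on \<kappa> (insert v A) \<and> inj_on \<kappa> (S - A)
       \<and> inj_on \<kappa> (insert d (S - A - {v}))) =
      (v \<in> S \<and> A \<subseteq> S - {v} \<and> card A = a \<and> inj_on \<kappa> (insert v A) \<and> inj_on \<kappa> (S - A))"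
      by blast
  qed
  then have "int (card (peaks \<kappa> S d a)) = (\<Sum>l\<le>a. (int (card S) - 2 * int l) * int (card (bisections \<kappa> S l)))"
    by (simp add: sum_card_bisections[OF S(1)])
  \<comment> \<open>Splits a + n - 2l as (a + 1 - l) + (n - 1 - l).\<close>
  also have "\<dots> = (\<Sum>l\<le>a. (int a + 1 - int l) * int (card (bisections \<kappa> S l)))
      + (\<Sum>l<a + 1 - 0. (int n - int 0 - 1 - int l) * int (card (bisections \<kappa> S l)))"
    unfolding S(3) by (simp add: sum.distrib[symmetric] lessThan_Suc_atMost algebra_simps)
  also have "\<dots> = (\<Sum>l\<le>card S. weight a n l * int (card (bisections \<kappa> S l)))"
    using S(3,4) card_bisections_complement[OF S(1), of _ \<kappa>] card_bisections_eq_0[OF S(1), of _ \<kappa>]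
    by (intro sum_weight_symmetric[symmetric]) simp_all
  also have "\<dots> = (\<Sum>L\<in>Pow S. weight a n (card L) * of_bool (inj_on \<kappa> L \<and> inj_on \<kappa> (S - L)))"
    by (rule sum_Pow_bisections[OF S(1), symmetric])
  also have "\<dots> = (\<Sum>L\<in>Pow S. weight a n (card L) * of_bool (inj_on \<kappa> (insert d L) \<and> inj_on \<kappa> (S - L)))"
    by (intro sum.cong refl) (simp only: ins[OF PowD])
  finally show ?thesis .
qed

text \<open>Since u has the colour of d, it must avoid the clique through d, so u is the gluing
  vertex v or lies in A. Deleting u leaves a bisection of \<open>S - {u}\<close> with first side A,
  respectively a hinge of \<open>S - {u}\<close> with a - 1 in place of a. On the right-hand side u
  is forced into \<open>S - L\<close>, so both sides become counts on
  \<open>S - {u}\<close>.\<close>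

lemma card_peaks_matched:
  assumes S: "finite S" "d \<notin> S" "card S = a + n" "n \<ge> 1"
    and u: "u \<in> S" "\<kappa> u = \<kappa> d" "\<kappa> d \<notin> \<kappa> ` (S - {u})"
  shows "int (card (peaks \<kappa> S d a)) =
    (\<Sum>L\<in>Pow S. weight a n (card L) * of_bool (inj_on \<kappa> (insert d L) \<and> inj_on \<kappa> (S - L)))"
proof -
  define S' where "S' = S - {u}"
  have S': "finite S'" "u \<notin> S'" "S = insert u S'" "card S' + 1 = a + n" "\<kappa> d \<notin> \<kappa> ` S'" "d \<noteq> u" "d \<notin> S'"
    using S u by (auto simp: S'_def insert_absorb)
  have fin: "A \<subseteq> S' \<Longrightarrow> finite A" for A
    using S'(1) finite_subset by blast
  have ins: "inj_on \<kappa> (insert d L) \<longleftrightarrow> inj_on \<kappa> L" "inj_on \<kappa> (insert u L) \<longleftrightarrow> inj_on \<kappa> L"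
    if "L \<subseteq> S'" for L
    using that S' u(2) by (auto simp: inj_on_insert)
  have bad: "\<not> inj_on \<kappa> (insert d L)" if "u \<in> L" for L
    using that u(2) S'(6) by (auto simp: inj_on_def)
  \<comment> \<open>The case a = 0 is separated because u \<in> A is then impossible, whereas a - 1
    would be truncated to 0.\<close>
  have "peaks \<kappa> S d a = (\<lambda>A. (A, u)) ` bisections \<kappa> S' a \<union>
      (\<lambda>(A, v). (insert u A, v)) ` (if a = 0 then {} else hinges \<kappa> S' (a - 1))" (is "_ = ?P \<union> ?Q")
  proof (intro equalityI subsetI)
    fix p assume p: "p \<in> peaks \<kappa> S d a"
    obtain A v where Av: "p = (A, v)" by force
    note * = p[unfolded Av peaks_def mem_Collect_eq prod.case]
    show "p \<in> ?P \<union> ?Q"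
    proof (cases "v = u")
      case True
      then have "A \<subseteq> S'" "S - A = insert u (S' - A)" using * S' by auto
      then have "A \<in> bisections \<kappa> S' a"
        using * True ins[of A] ins[of "S' - A"] by (auto simp: bisections_def)
      then show ?thesis using True Av by auto
    next
      case False
      then have uA: "u \<in> A" using * bad[of "S - A - {v}"] S' by blast
      define A' where "A' = A - {u}"
      have A': "A = insert u A'" "u \<notin> A'" "A' \<subseteq> S' - {v}" "v \<in> S'"
        using uA * S' False by (auto simp: A'_def)
      have "S - A = S' - A'" using S' A' by auto
      moreover have "card A' = a - 1" "a \<noteq> 0"
      proof -
        have "A' \<subseteq> S'" using A'(3) by blast
        then have "card A = Suc (card A')" using A'(1,2) fin by simp
        then show "card A' = a - 1" "a \<noteq> 0" using * by simp_all
      qed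
      moreover have "inj_on \<kappa> (insert v A')"
        by (rule inj_on_subset[of _ "insert v A"]) (use * A' in auto)
      ultimately have "(A', v) \<in> hinges \<kappa> S' (a - 1)"
        using A' * by (auto simp: hinges_def)
      then show ?thesis using A' Av \<open>a \<noteq> 0\<close> by force
    qed
  next
    fix p assume "p \<in> ?P \<union> ?Q"
    then consider A where "p = (A, u)" "A \<in> bisections \<kappa> S' a"
      | A v where "p = (insert u A, v)" "a \<noteq> 0" "(A, v) \<in> hinges \<kappa> S' (a - 1)"
      by (auto split: if_splits)
    then show "p \<in> peaks \<kappa> S d a"
    proof cases
      case 1
      then have "A \<subseteq> S'" "S - A = insert u (S' - A)" "S - A - {u} = S' - A"
        using S' by (auto simp: bisections_def)
      then show ?thesis using 1 S' ins[of A] ins[of "S' - A"]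
        by (auto simp: bisections_def peaks_def)
    next
      case 2
      then have A: "A \<subseteq> S' - {v}" "v \<in> S'" "card A = a - 1" "inj_on \<kappa> (insert v A)" "inj_on \<kappa> (S' - A)"
        by (auto simp: hinges_def)
      have "S - insert u A = S' - A" using S' by auto
      moreover have "inj_on \<kappa> (insert v (insert u A))"
        using ins(2)[of "insert v A"] A by (auto simp: insert_commute)
      moreover have "inj_on \<kappa> (insert d (S' - A - {v}))"
        using ins(1)[of "S' - A - {v}"] A(5) by (auto intro: inj_on_subset)
      moreover have "card (insert u A) = a"
        using A 2(2) S' fin[of A] by (subst card_insert_disjoint) auto
      ultimately show ?thesis
        using A S' 2 by (auto simp: peaks_def)
    qed
  qed
  moreover have "card (?P \<union> ?Q) = card ?P + card ?Q"
    using S' finite_subset[of "hinges \<kappa> S' (a - 1)" "Pow S' \<times> S'"]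
    by (intro card_Un_disjoint) (auto simp: finite_bisections hinges_def)
  moreover have "card ?P = card (bisections \<kappa> S' a)"
    by (rule card_image) (auto simp: inj_on_def)
  moreover have "int (card ?Q) = (\<Sum>l<a. (int (card S') - 2 * int l) * int (card (bisections \<kappa> S' l)))"
  proof (cases a)
    case (Suc a')
    have "inj_on (\<lambda>(A, v). (insert u A, v)) (hinges \<kappa> S' a')"
    proof (rule inj_onI)
      fix p q assume pq: "p \<in> hinges \<kappa> S' a'" "q \<in> hinges \<kappa> S' a'"
        and eq: "(case p of (A, v) \<Rightarrow> (insert u A, v)) = (case q of (A, v) \<Rightarrow> (insert u A, v))"
      then have "u \<notin> fst p" "u \<notin> fst q" using S' by (auto simp: hinges_def)
      with eq show "p = q" by (cases p; cases q) (simp add: insert_ident)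
    qed
    then show ?thesis
      using sum_card_bisections[OF S'(1), of \<kappa> a'] Suc by (simp add: card_image lessThan_Suc_atMost)
  qed simp
  ultimately have "int (card (peaks \<kappa> S d a)) = int (card (bisections \<kappa> S' a)) +
      (\<Sum>l<a. (int (card S') - 2 * int l) * int (card (bisections \<kappa> S' l)))"
    by simp
  \<comment> \<open>At l = a the first sum contributes the bisections from v = u; for l < a the two
    factors add up to a + n - 1 - 2l, where \<open>card S'\<close> is a + n - 1.\<close>
  also have "\<dots> = (\<Sum>l\<le>a. (int a + 1 - int l) * int (card (bisections \<kappa> S' l)))
      + (\<Sum>l<a + 1 - 1. (int n - int 1 - 1 - int l) * int (card (bisections \<kappa> S' l)))"
  proof -
    have N: "int (card S') = int a + int n - 1" using S'(4) by linarith
    show ?thesis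
      unfolding N by (simp add: lessThan_Suc_atMost[symmetric] sum.distrib[symmetric] algebra_simps)
  qed
  also have "\<dots> = (\<Sum>l\<le>card S'. weight a n l * int (card (bisections \<kappa> S' l)))"
    using S(4) S'(4) card_bisections_complement[OF S'(1), of _ \<kappa>] card_bisections_eq_0[OF S'(1), of _ \<kappa>]
    by (intro sum_weight_symmetric[symmetric]) simp_all
  also have "\<dots> = (\<Sum>L\<in>Pow S'. weight a n (card L) * of_bool (inj_on \<kappa> L \<and> inj_on \<kappa> (S' - L)))"
    by (rule sum_Pow_bisections[OF S'(1), symmetric])
  also have "\<dots> = (\<Sum>L\<in>Pow S. weight a n (card L) * of_bool (inj_on \<kappa> (insert d L) \<and> inj_on \<kappa> (S - L)))"
  proof (rule sum.mono_neutral_cong_left)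
    fix L assume L: "L \<in> Pow S'"
    then have "S - L = insert u (S' - L)" using S' by auto
    then show "weight a n (card L) * of_bool (inj_on \<kappa> L \<and> inj_on \<kappa> (S' - L)) =
        weight a n (card L) * of_bool (inj_on \<kappa> (insert d L) \<and> inj_on \<kappa> (S - L))"
      using L ins[of L] ins[of "S' - L"] by (auto simp: of_bool_def)
  qed (use S S' bad in auto)
  finally show ?thesis .
qed

text \<open>If two vertices of S share the colour of d, both sides vanish: each of the two must
  avoid the block of d, so both lie in \<open>insert v A\<close>, respectively in
  \<open>S - L\<close>, where a colour occurs only once.\<close>

lemma card_peaks:
  assumes S: "finite S" "d \<notin> S" "card S = a + n" "n \<ge> 1"
  shows "int (card (peaks \<kappa> S d a)) =
    (\<Sum>L\<in>Pow S. weight a n (card L) * of_bool (inj_on \<kappa> (insert d L) \<and> inj_on \<kappa> (S - L)))"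
proof -
  consider "\<kappa> d \<notin> \<kappa> ` S" | u where "u \<in> S" "\<kappa> u = \<kappa> d" "\<kappa> d \<notin> \<kappa> ` (S - {u})"
    | u u' where "u \<in> S" "u' \<in> S" "u \<noteq> u'" "\<kappa> u = \<kappa> d" "\<kappa> u' = \<kappa> d"
  proof (cases "\<kappa> d \<in> \<kappa> ` S")
    case True
    then obtain u where "u \<in> S" "\<kappa> u = \<kappa> d" by auto
    then show ?thesis
      using that(2)[of u] that(3)[of u] by (cases "\<exists>u'\<in>S - {u}. \<kappa> u' = \<kappa> d") (force simp: image_iff)+
  qed (rule that(1))
  then show ?thesis
  proof cases
    case 3
    have False if "inj_on \<kappa> (insert d L)" "inj_on \<kappa> (S - L)" for L
      using that 3 S(2) by (metis DiffI inj_on_eq_iff insertCI)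
    then have "(\<Sum>L\<in>Pow S. weight a n (card L) * of_bool (inj_on \<kappa> (insert d L) \<and> inj_on \<kappa> (S - L))) = 0"
      by (intro sum.neutral) auto
    moreover have "peaks \<kappa> S d a = {}"
    proof -
      have False if Av: "inj_on \<kappa> (insert v A)" "inj_on \<kappa> (S - A)" "inj_on \<kappa> (insert d (S - A - {v}))" for A v
      proof -
        have "u \<in> insert v A" if "u \<in> S" "\<kappa> u = \<kappa> d" for u
          using that Av(3) S(2) by (auto simp: inj_on_def)
        then show False
          using 3 Av(1) by (metis inj_onD)
      qed
      then show ?thesis by (auto simp: peaks_def)
    qed
    ultimately show ?thesis by simp
  qed (use card_peaks_unmatched[OF S] card_peaks_matched[OF S] in auto)
qed

section \<open>The elementary basis\<close>

text \<open>Lets identities of series be checked one colouring at a time. Vertex i is read at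
  position i - 1, and words containing 0 are not colourings. The colouring read off a word is
  meaningless outside {1..d}, hence the later hypotheses that F depends only on {1..d}.\<close>

definition colour_series :: "nat \<Rightarrow> ((nat \<Rightarrow> nat) \<Rightarrow> rat) \<Rightarrow> ncseries" where
  "colour_series d F = (\<lambda>w. if length w = d \<and> 0 \<notin> set w then F (\<lambda>i. w ! (i - 1)) else 0)"

text \<open>The cardinality in \<open>monomial_sum\<close> is 0 or 1: a word fixes a colouring on
  {1..d}, and members of \<open>tuples d\<close> are extensional.\<close>

lemma monomial_sum_eq_colour_series:
  assumes "\<And>\<kappa> \<kappa>'. (\<And>i. i \<in> {1..d} \<Longrightarrow> \<kappa> i = \<kappa>' i) \<Longrightarrow> Q \<kappa> = Q \<kappa>'"
  shows "monomial_sum d {\<kappa> \<in> tuples d. Q \<kappa>} = colour_series d (\<lambda>\<kappa>. of_bool (Q \<kappa>))"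
proof
  fix w :: "nat list"
  let ?w = "\<lambda>i. w ! (i - 1)"
  let ?K = "{\<kappa> \<in> {\<kappa> \<in> tuples d. Q \<kappa>}. map \<kappa> [1..<d + 1] = w}"
  have nth: "map \<kappa> [1..<d + 1] = w \<longleftrightarrow> length w = d \<and> (\<forall>i\<in>{1..d}. \<kappa> i = ?w i)" for \<kappa>
  proof -
    have "(\<forall>i<d. \<kappa> (1 + i) = w ! i) \<longleftrightarrow> (\<forall>i\<in>{1..d}. \<kappa> i = ?w i)"
    proof safe
      fix i assume "\<forall>i<d. \<kappa> (1 + i) = w ! i" "i \<in> {1..d}"
      then show "\<kappa> i = ?w i" by (cases i) auto
    next
      fix i assume "\<forall>i\<in>{1..d}. \<kappa> i = ?w i" "i < d"
      then show "\<kappa> (1 + i) = w ! i" by (auto dest: bspec[of _ _ "1 + i"])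
    qed
    moreover have "map \<kappa> [1..<d + 1] = w \<longleftrightarrow> length w = d \<and> (\<forall>i<d. \<kappa> (1 + i) = w ! i)"
      unfolding list_eq_iff_nth_eq by (auto simp del: upt_Suc)
    ultimately show ?thesis by blast
  qed
  have set: "0 \<notin> set w \<longleftrightarrow> (\<forall>i\<in>{1..d}. ?w i \<ge> 1)" if "length w = d"
  proof -
    have "set w = ?w ` {1..d}"
      using that by (force simp: set_conv_nth image_iff intro: bexI[of _ "Suc _"])
    then show ?thesis by force
  qed
  show "monomial_sum d {\<kappa> \<in> tuples d. Q \<kappa>} w = colour_series d (\<lambda>\<kappa>. of_bool (Q \<kappa>)) w"
  proof (cases "length w = d \<and> 0 \<notin> set w \<and> Q ?w")
    case True
    have "?K = {restrict ?w {1..d}}"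
    proof (intro equalityI subsetI)
      fix \<kappa> assume "\<kappa> \<in> ?K"
      then have "\<kappa> \<in> extensional {1..d}" "\<forall>i\<in>{1..d}. \<kappa> i = ?w i"
        unfolding mem_Collect_eq nth by (auto simp: tuples_def PiE_def)
      then show "\<kappa> \<in> {restrict ?w {1..d}}"
        by (auto simp: extensional_def restrict_def fun_eq_iff)
    next
      fix \<kappa> assume "\<kappa> \<in> {restrict ?w {1..d}}"
      then have \<kappa>: "\<kappa> = restrict ?w {1..d}" by simp
      have "Q \<kappa> = Q ?w" by (rule assms) (simp add: \<kappa>)
      with True set show "\<kappa> \<in> ?K"
        unfolding mem_Collect_eq nth by (auto simp: tuples_def \<kappa>)
    qed
    with True show ?thesis
      by (simp add: monomial_sum_def colour_series_def)
  next
    case False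
    have "?K = {}"
    proof (intro equals0I)
      fix \<kappa> assume "\<kappa> \<in> ?K"
      then have \<kappa>: "\<kappa> \<in> tuples d" "Q \<kappa>" "length w = d" "\<forall>i\<in>{1..d}. \<kappa> i = ?w i"
        unfolding mem_Collect_eq nth by auto
      moreover have "Q \<kappa> = Q ?w" using \<kappa> by (intro assms) auto
      ultimately show False using False set by (auto simp: tuples_def PiE_def Pi_def)
    qed
    then have "monomial_sum d {\<kappa> \<in> tuples d. Q \<kappa>} w = 0"
      by (simp only: monomial_sum_def card.empty of_nat_0)
    with False show ?thesis
      by (auto simp: colour_series_def)
  qed
qed

text \<open>Blocks may overlap: for a union of cliques this is properness of the colouring, for a
  set partition the condition defining e_\<pi>.\<close>

definition injective_on_blocks :: "nat set set \<Rightarrow> (nat \<Rightarrow> nat) \<Rightarrow> bool" where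
  "injective_on_blocks \<pi> \<kappa> \<longleftrightarrow> (\<forall>B\<in>\<pi>. inj_on \<kappa> B)"

lemma block_eq:
  assumes "partition_on A \<pi>" and "B \<in> \<pi>" and "i \<in> B"
  shows "block \<pi> i = B"
  unfolding block_def
  using assms by (intro the_equality) (auto simp: partition_on_def disjoint_def)

lemma nc_e_eq:
  assumes "\<pi> \<in> set_partitions d"
  shows "nc_e d \<pi> = colour_series d (\<lambda>\<kappa>. of_bool (injective_on_blocks \<pi> \<kappa>))"
proof -
  have \<pi>: "partition_on {1..d} \<pi>" using assms by (simp add: set_partitions_def)
  have eq: "(\<forall>j\<in>{1..d}. \<forall>k\<in>{1..d}. j \<noteq> k \<and> block \<pi> j = block \<pi> k \<longrightarrow> \<kappa> j \<noteq> \<kappa> k) = injective_on_blocks \<pi> \<kappa>"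
    for \<kappa> :: "nat \<Rightarrow> nat"
  proof
    assume *: "\<forall>j\<in>{1..d}. \<forall>k\<in>{1..d}. j \<noteq> k \<and> block \<pi> j = block \<pi> k \<longrightarrow> \<kappa> j \<noteq> \<kappa> k"
    show "injective_on_blocks \<pi> \<kappa>"
      unfolding injective_on_blocks_def
    proof (intro ballI inj_onI, rule ccontr)
      fix B j k assume "B \<in> \<pi>" "j \<in> B" "k \<in> B" "\<kappa> j = \<kappa> k" "j \<noteq> k"
      moreover from this have "j \<in> {1..d}" "k \<in> {1..d}" using partition_onD1[OF \<pi>] by auto
      ultimately show False using * block_eq[OF \<pi>] by metis
    qed
  next
    assume *: "injective_on_blocks \<pi> \<kappa>"
    show "\<forall>j\<in>{1..d}. \<forall>k\<in>{1..d}. j \<noteq> k \<and> block \<pi> j = block \<pi> k \<longrightarrow> \<kappa> j \<noteq> \<kappa> k"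
    proof (intro ballI impI)
      fix j k assume "j \<in> {1..d}" "k \<in> {1..d}" and jk: "j \<noteq> k \<and> block \<pi> j = block \<pi> k"
      then obtain B C where "B \<in> \<pi>" "j \<in> B" "C \<in> \<pi>" "k \<in> C"
        using partition_onD1[OF \<pi>] by blast
      with jk block_eq[OF \<pi>] have "B = C" by metis
      with * \<open>B \<in> \<pi>\<close> \<open>j \<in> B\<close> \<open>k \<in> C\<close> jk show "\<kappa> j \<noteq> \<kappa> k"
        by (auto simp: injective_on_blocks_def inj_on_def)
    qed
  qed
  show ?thesis
    unfolding nc_e_def eq
  proof (rule monomial_sum_eq_colour_series)
    fix \<kappa> \<kappa>' :: "nat \<Rightarrow> nat" assume "\<And>i. i \<in> {1..d} \<Longrightarrow> \<kappa> i = \<kappa>' i"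
    then show "injective_on_blocks \<pi> \<kappa> = injective_on_blocks \<pi> \<kappa>'"
      unfolding injective_on_blocks_def using UnionI[of _ \<pi>, folded partition_onD1[OF \<pi>]]
      by (intro ball_cong refl inj_on_cong) blast
  qed
qed

lemma chromatic_Y_eq:
  assumes "E \<subseteq> complete_graph d"
  shows "chromatic_Y d E = colour_series d (\<lambda>\<kappa>. of_bool (\<forall>i j. {i, j} \<in> E \<longrightarrow> \<kappa> i \<noteq> \<kappa> j))"
  unfolding chromatic_Y_def
proof (rule monomial_sum_eq_colour_series)
  fix \<kappa> \<kappa>' :: "nat \<Rightarrow> nat" assume *: "\<And>i. i \<in> {1..d} \<Longrightarrow> \<kappa> i = \<kappa>' i"
  have "i \<in> {1..d} \<and> j \<in> {1..d}" if "{i, j} \<in> E" for i j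
    using that assms by (auto simp: complete_graph_def doubleton_eq_iff)
  with * show "(\<forall>i j. {i, j} \<in> E \<longrightarrow> \<kappa> i \<noteq> \<kappa> j) = (\<forall>i j. {i, j} \<in> E \<longrightarrow> \<kappa>' i \<noteq> \<kappa>' j)"
    by metis
qed

text \<open>Removing x either deletes its block or leaves a nonempty rest, so a partition grows by
  one element in exactly these two ways.\<close>

lemma partition_on_induct [consumes 2, case_names empty singleton extend]:
  assumes "finite X" and "partition_on X \<tau>"
    and "P {} {}"
    and "\<And>x X \<tau>. finite X \<Longrightarrow> partition_on X \<tau> \<Longrightarrow> x \<notin> X \<Longrightarrow> P X \<tau> \<Longrightarrow> P (insert x X) (insert {x} \<tau>)"
    and "\<And>x X \<tau> B. finite X \<Longrightarrow> partition_on X \<tau> \<Longrightarrow> x \<notin> X \<Longrightarrow> B \<in> \<tau> \<Longrightarrow> P X \<tau> \<Longrightarrow>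
      P (insert x X) (insert (insert x B) (\<tau> - {B}))"
  shows "P X \<tau>"
  using assms(1,2)
proof (induction X arbitrary: \<tau>)
  case empty
  then show ?case using assms(3) by (simp add: partition_on_empty)
next
  case (insert x X)
  obtain B where B: "B \<in> \<tau>" "x \<in> B"
    using partition_onD1[OF insert.prems] by blast
  let ?\<tau> = "\<tau> - {B}"
  have disj: "disjnt B (\<Union>?\<tau>)"
    using partition_onD2[OF insert.prems] B by (auto simp: disjoint_def disjnt_def)
  have \<tau>: "\<tau> = insert B ?\<tau>" using B by auto
  have part: "partition_on (insert x X - B) ?\<tau>" "B \<subseteq> insert x X"
    using insert.prems partition_on_insert[OF disj] \<tau> by auto
  show ?case
  proof (cases "B = {x}")
    case True
    then have "partition_on X ?\<tau>" using part insert.hyps by simp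
    then have "P (insert x X) (insert {x} ?\<tau>)"
      using insert by (intro assms(4)) auto
    then show ?thesis using \<tau> True by simp
  next
    case False
    let ?B = "B - {x}"
    have ne: "?B \<notin> ?\<tau>"
      using disj B False by (auto simp: disjnt_def)
    have "disjnt ?B (\<Union>?\<tau>)" using disj by (auto simp: disjnt_def)
    moreover have "X - ?B = insert x X - B" using insert.hyps B by auto
    ultimately have "partition_on X (insert ?B ?\<tau>)"
      using part False B by (subst partition_on_insert) auto
    then have "P (insert x X) (insert (insert x ?B) (insert ?B ?\<tau> - {?B}))"
      using insert by (intro assms(5)) auto
    also have "insert (insert x ?B) (insert ?B ?\<tau> - {?B}) = \<tau>"
      using ne \<tau> B by (auto simp: insert_absorb)
    finally show ?thesis .
  qed
qed

lemma partition_on_insert_singleton: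
  assumes "partition_on X \<tau>" and "x \<notin> X"
  shows "partition_on (insert x X) (insert {x} \<tau>)"
  using assms by (subst partition_on_insert) (auto simp: disjnt_def partition_on_def)

lemma partition_on_extend_block:
  assumes "partition_on X \<tau>" and "x \<notin> X" and "B \<in> \<tau>"
  shows "partition_on (insert x X) (insert (insert x B) (\<tau> - {B}))"
proof -
  have "disjnt B (\<Union>(\<tau> - {B}))"
    using partition_onD2[OF assms(1)] assms(3) by (auto simp: disjoint_def disjnt_def)
  moreover from this have "partition_on (X - B) (\<tau> - {B})" "B \<subseteq> X"
    using assms partition_on_insert[of B "\<tau> - {B}" X] by (auto simp: insert_absorb)
  moreover have "disjnt (insert x B) (\<Union>(\<tau> - {B}))"
    using calculation assms by (auto simp: disjnt_def partition_on_def)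
  moreover have "insert x X - insert x B = X - B" using assms by auto
  ultimately show ?thesis
    by (subst partition_on_insert) auto
qed

lemma sum_series_apply: "(\<Sum>x\<in>A. f x) w = (\<Sum>x\<in>A. f x w)" for f :: "'a \<Rightarrow> ncseries"
  by (induction A rule: infinite_finite_induct) auto

lemma colour_series_sum: "colour_series d (\<lambda>\<kappa>. \<Sum>x\<in>A. F x \<kappa>) = (\<Sum>x\<in>A. colour_series d (F x))"
  by (rule ext) (auto simp: colour_series_def sum_series_apply intro: sum.neutral)

lemma colour_series_scale: "colour_series d (\<lambda>\<kappa>. c * F \<kappa>) = ncscale c (colour_series d F)"
  by (rule ext) (simp add: colour_series_def ncscale_def)

lemma colour_series_diff: "colour_series d (\<lambda>\<kappa>. F \<kappa> - G \<kappa>) = colour_series d F - colour_series d G"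
  by (rule ext) (simp add: colour_series_def)

section \<open>Triangular expansion of the e in power sums\<close>

definition constant_on_blocks :: "nat set set \<Rightarrow> (nat \<Rightarrow> nat) \<Rightarrow> bool" where
  "constant_on_blocks \<pi> \<kappa> \<longleftrightarrow> (\<forall>B\<in>\<pi>. \<forall>i\<in>B. \<forall>j\<in>B. \<kappa> i = \<kappa> j)"

text \<open>Agrees with \<open>nc_e\<close> on set partitions of {1..d}, but also makes sense for
  overlapping blocks and for blocks that miss some vertices.\<close>

definition e_series :: "nat \<Rightarrow> nat set set \<Rightarrow> ncseries" where
  "e_series d \<pi> = colour_series d (\<lambda>\<kappa>. of_bool (injective_on_blocks \<pi> \<kappa>))"

text \<open>The power sum p_\<pi> in noncommuting variables.\<close>

definition p_series :: "nat \<Rightarrow> nat set set \<Rightarrow> ncseries" where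
  "p_series d \<pi> = colour_series d (\<lambda>\<kappa>. of_bool (constant_on_blocks \<pi> \<kappa>))"

lemma span_map:
  assumes "f \<in> nc.span A" and "module_hom ncscale ncscale T" and "\<And>a. a \<in> A \<Longrightarrow> T a \<in> nc.span B"
  shows "T f \<in> nc.span B"
  using assms(1)
proof (induction rule: nc.span_induct_alt)
  case base
  then show ?case unfolding module_hom.zero[OF assms(2)] by (rule nc.span_zero)
next
  case (step c x y)
  then show ?case
    unfolding module_hom.add[OF assms(2)] module_hom.scale[OF assms(2)]
    using step by (intro nc.span_add nc.span_scale) (auto intro: assms(3))
qed

lemma card_extend_block:
  assumes "finite X" and "partition_on X \<tau>" and "x \<notin> X" and "B \<in> \<tau>"
  shows "card (insert (insert x B) (\<tau> - {B})) = card \<tau>"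
proof -
  have "finite \<tau>" using finite_elements[OF assms(1,2)] .
  moreover have "insert x B \<notin> \<tau>"
    using partition_onD1[OF assms(2)] assms(3) by blast
  ultimately show ?thesis
    using assms(4) card_Suc_Diff1[of \<tau> B] by simp
qed

lemma card_insert_singleton:
  assumes "finite X" and "partition_on X \<tau>" and "x \<notin> X"
  shows "card (insert {x} \<tau>) = Suc (card \<tau>)"
proof -
  have "finite \<tau>" using finite_elements[OF assms(1,2)] .
  moreover have "{x} \<notin> \<tau>"
    using partition_onD1[OF assms(2)] assms(3) by blast
  ultimately show ?thesis by simp
qed

lemma constant_on_blocks_extend:
  assumes "B \<in> \<tau>" and "y \<in> B"
  shows "constant_on_blocks (insert (insert x B) (\<tau> - {B})) \<kappa> \<longleftrightarrow> constant_on_blocks \<tau> \<kappa> \<and> \<kappa> x = \<kappa> y"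
proof -
  define Q where "Q C \<longleftrightarrow> (\<forall>i\<in>C. \<forall>j\<in>C. \<kappa> i = \<kappa> j)" for C
  have Q: "Q C \<longleftrightarrow> (\<forall>i\<in>C. \<kappa> i = \<kappa> y)" if "y \<in> C" for C
    unfolding Q_def using that by metis
  have "Q (insert x B) \<longleftrightarrow> Q B \<and> \<kappa> x = \<kappa> y"
    using Q[of B] Q[of "insert x B"] assms(2) by blast
  then have "(\<forall>C\<in>insert (insert x B) (\<tau> - {B}). Q C) \<longleftrightarrow> (\<forall>C\<in>\<tau>. Q C) \<and> \<kappa> x = \<kappa> y"
    using assms(1) by blast
  then show ?thesis
    unfolding constant_on_blocks_def Q_def .
qed

text \<open>If \<open>\<kappa>\<close> is injective on \<open>B\<close>, then \<open>\<kappa> x\<close> agrees with at most one of the colours on \<open>B\<close>, so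
  injectivity on \<open>insert x B\<close> is cut out by the factor \<open>1 - (\<Sum>y\<in>B. of_bool (\<kappa> x = \<kappa> y))\<close>.\<close>

lemma injective_on_blocks_extend:
  assumes "finite B" and "B \<in> \<tau>" and "x \<notin> B"
  shows "(of_bool (injective_on_blocks (insert (insert x B) (\<tau> - {B})) \<kappa>) :: rat) =
    of_bool (injective_on_blocks \<tau> \<kappa>) * (1 - (\<Sum>y\<in>B. of_bool (\<kappa> x = \<kappa> y)))"
proof (cases "injective_on_blocks \<tau> \<kappa>")
  case True
  then have inj: "inj_on \<kappa> B" using assms by (auto simp: injective_on_blocks_def)
  have "(\<Sum>y\<in>B. of_bool (\<kappa> x = \<kappa> y) :: rat) = (\<Sum>c\<in>\<kappa> ` B. of_bool (\<kappa> x = c))"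
    using inj by (simp add: sum.reindex)
  also have "\<dots> = of_bool (\<kappa> x \<in> \<kappa> ` B)"
    using assms by (simp add: of_bool_def sum.delta)
  finally show ?thesis
    using True assms by (auto simp: injective_on_blocks_def)
next
  case False
  then have "\<not> injective_on_blocks (insert (insert x B) (\<tau> - {B})) \<kappa>"
    using assms by (auto simp: injective_on_blocks_def)
  with False show ?thesis by simp
qed

text \<open>Putting x into the block B multiplies e by 1 - (\<Sum>y\<in>B.
  [\<kappa> x = \<kappa> y]). On a power sum, the term 1 adds a singleton and raises the number of
  blocks, while each bracket adds x to the block of y and preserves that number; so partitions with
  more blocks than \<tau> form a remainder that the induction carries along. That \<mu> is nonzero
  allows the system to be inverted later.\<close>

lemma e_series_triangular:
  assumes "finite X" and "partition_on X \<tau>" and "X \<subseteq> {1..d}"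
  shows "\<exists>\<mu>. \<mu> \<noteq> 0 \<and> e_series d \<tau> - ncscale \<mu> (p_series d \<tau>) \<in>
    nc.span (p_series d ` {\<rho>. partition_on X \<rho> \<and> card \<tau> < card \<rho>})"
  using assms
proof (induction rule: partition_on_induct)
  case empty
  have "e_series d {} - ncscale 1 (p_series d {}) = 0"
    by (simp add: e_series_def p_series_def injective_on_blocks_def constant_on_blocks_def)
  then show ?case using nc.span_zero by (metis one_neq_zero)
next
  case (singleton x X \<tau>)
  then obtain \<mu> where \<mu>: "\<mu> \<noteq> 0" "e_series d \<tau> - ncscale \<mu> (p_series d \<tau>) \<in>
    nc.span (p_series d ` {\<rho>. partition_on X \<rho> \<and> card \<tau> < card \<rho>})" by blast
  have e: "e_series d (insert {x} \<tau>) = e_series d \<tau>"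
    by (simp add: e_series_def injective_on_blocks_def)
  have p: "p_series d (insert {x} \<rho>) = p_series d \<rho>" for \<rho>
    by (simp add: p_series_def constant_on_blocks_def)
  have "p_series d ` {\<rho>. partition_on X \<rho> \<and> card \<tau> < card \<rho>} \<subseteq>
    p_series d ` {\<rho>. partition_on (insert x X) \<rho> \<and> card (insert {x} \<tau>) < card \<rho>}"
  proof clarify
    fix \<rho> assume "partition_on X \<rho>" "card \<tau> < card \<rho>"
    then have "partition_on (insert x X) (insert {x} \<rho>)" "card (insert {x} \<tau>) < card (insert {x} \<rho>)"
      using singleton by (auto simp: card_insert_singleton partition_on_insert_singleton)
    then show "p_series d \<rho> \<in> p_series d ` {\<rho>. partition_on (insert x X) \<rho> \<and> card (insert {x} \<tau>) < card \<rho>}"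
      by (intro image_eqI[of _ _ "insert {x} \<rho>"]) (auto simp: p)
  qed
  with \<mu> nc.span_mono show ?case
    unfolding e p by blast
next
  case (extend x X \<tau> B)
  then obtain \<mu> where \<mu>: "\<mu> \<noteq> 0" "e_series d \<tau> - ncscale \<mu> (p_series d \<tau>) \<in>
    nc.span (p_series d ` {\<rho>. partition_on X \<rho> \<and> card \<tau> < card \<rho>})" by blast
  have B: "finite B" "x \<notin> B" "B \<noteq> {}" "B \<subseteq> X"
    using extend finite_subset[of B X] by (auto simp: partition_on_def)
  let ?\<tau> = "insert (insert x B) (\<tau> - {B})"
  let ?S = "nc.span (p_series d ` {\<rho>. partition_on (insert x X) \<rho> \<and> card ?\<tau> < card \<rho>})"
  \<comment> \<open>Multiplication by this factor acts on the coefficient of each word separately,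
    hence linearly on all series.\<close>
  define T :: "ncseries \<Rightarrow> ncseries" where
    "T f = (\<lambda>w. f w * (1 - (\<Sum>y\<in>B. of_bool (w ! (x - 1) = w ! (y - 1)))))" for f
  have hom: "module_hom ncscale ncscale T"
    by unfold_locales (auto simp: T_def ncscale_def algebra_simps fun_eq_iff)
  have T_colour: "T (colour_series d F) =
      colour_series d (\<lambda>\<kappa>. F \<kappa> * (1 - (\<Sum>y\<in>B. of_bool (\<kappa> x = \<kappa> y))))" for F
    by (rule ext) (simp add: T_def colour_series_def)
  have T_e: "T (e_series d \<tau>) = e_series d ?\<tau>"
    unfolding e_series_def T_colour using B extend by (simp add: injective_on_blocks_extend)
  define ext where "ext \<rho> y = (let C = block \<rho> y in insert (insert x C) (\<rho> - {C}))" for \<rho> y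
  have T_p: "T (p_series d \<rho>) = p_series d (insert {x} \<rho>) - (\<Sum>y\<in>B. p_series d (ext \<rho> y))"
    if "partition_on X \<rho>" for \<rho>
  proof -
    have "of_bool (constant_on_blocks (ext \<rho> y) \<kappa>) =
        (of_bool (constant_on_blocks \<rho> \<kappa>) :: rat) * of_bool (\<kappa> x = \<kappa> y)" if "y \<in> B" for y \<kappa>
    proof -
      obtain C where C: "C \<in> \<rho>" "y \<in> C"
        using \<open>y \<in> B\<close> B(4) partition_onD1[OF \<open>partition_on X \<rho>\<close>] by blast
      then show ?thesis
        using block_eq[OF \<open>partition_on X \<rho>\<close> C] constant_on_blocks_extend[OF C]
        by (simp add: ext_def)
    qed
    moreover have "constant_on_blocks (insert {x} \<rho>) \<kappa> = constant_on_blocks \<rho> \<kappa>" for \<kappa>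
      by (simp add: constant_on_blocks_def)
    ultimately have "of_bool (constant_on_blocks \<rho> \<kappa>) * (1 - (\<Sum>y\<in>B. of_bool (\<kappa> x = \<kappa> y))) =
        (of_bool (constant_on_blocks (insert {x} \<rho>) \<kappa>) :: rat)
          - (\<Sum>y\<in>B. of_bool (constant_on_blocks (ext \<rho> y) \<kappa>))" for \<kappa>
      by (simp add: right_diff_distrib sum_distrib_left)
    then show ?thesis
      unfolding p_series_def T_colour by (simp only: colour_series_diff colour_series_sum)
  qed
  have card_ext: "partition_on (insert x X) (ext \<rho> y) \<and> card (ext \<rho> y) = card \<rho>"
    if "partition_on X \<rho>" "y \<in> B" for \<rho> y
  proof -
    obtain C where C: "C \<in> \<rho>" "y \<in> C"
      using \<open>y \<in> B\<close> B(4) partition_onD1[OF \<open>partition_on X \<rho>\<close>] by blast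
    then show ?thesis
      using block_eq[OF that(1) C] card_extend_block[of X \<rho> x C] partition_on_extend_block[of X \<rho> x C] that extend
      by (simp add: ext_def)
  qed
  have card_\<tau>: "card ?\<tau> = card \<tau>"
    using extend by (intro card_extend_block) auto
  have in_S: "p_series d \<rho> \<in> ?S" if "partition_on (insert x X) \<rho>" "card \<tau> < card \<rho>" for \<rho>
    using that by (intro nc.span_base) (auto simp: card_\<tau>)
  have "T (e_series d \<tau> - ncscale \<mu> (p_series d \<tau>)) \<in> ?S"
  proof (rule span_map[OF \<mu>(2) hom], clarify)
    fix \<rho> assume \<rho>: "partition_on X \<rho>" "card \<tau> < card \<rho>"
    then show "T (p_series d \<rho>) \<in> ?S"
      using extend card_ext[OF \<rho>(1)]
      by (auto simp: T_p card_insert_singleton partition_on_insert_singleton intro!: nc.span_diff nc.span_sum in_S)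
  qed
  moreover have "p_series d (insert {x} \<tau>) \<in> ?S"
    using extend by (intro in_S) (auto simp: card_insert_singleton partition_on_insert_singleton)
  \<comment> \<open>Every y in B gives the same extension \<open>?\<tau>\<close>, so the leading
    coefficient picks up the factor -|B|; the singleton term has one more block and joins the
    remainder.\<close>
  moreover have "e_series d ?\<tau> - ncscale (- \<mu> * of_nat (card B)) (p_series d ?\<tau>) =
      T (e_series d \<tau> - ncscale \<mu> (p_series d \<tau>)) + ncscale \<mu> (p_series d (insert {x} \<tau>))"
  proof -
    have "ext \<tau> y = ?\<tau>" if "y \<in> B" for y
      using block_eq[of X \<tau> B y] that extend by (simp add: ext_def)
    then have T_\<tau>: "T (p_series d \<tau>) = p_series d (insert {x} \<tau>) - ncscale (of_nat (card B)) (p_series d ?\<tau>)"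
      using extend by (simp add: T_p ncscale_def fun_eq_iff)
    show ?thesis
      unfolding module_hom.diff[OF hom] module_hom.scale[OF hom] T_e T_\<tau>
      by (simp add: fun_eq_iff ncscale_def algebra_simps)
  qed
  ultimately have "e_series d ?\<tau> - ncscale (- \<mu> * of_nat (card B)) (p_series d ?\<tau>) \<in> ?S"
    by (simp add: nc.span_add nc.span_scale)
  moreover have "- \<mu> * of_nat (card B) \<noteq> 0" using \<mu>(1) B by simp
  ultimately show ?case by blast
qed

text \<open>Solves the triangular system, starting from the partitions with most blocks.\<close>

lemma p_series_in_span_e:
  assumes "\<tau> \<in> set_partitions d"
  shows "p_series d \<tau> \<in> nc.span (nc_e d ` set_partitions d)"
  using assms
proof (induction "d - card \<tau>" arbitrary: \<tau> rule: less_induct)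
  case less
  let ?S = "nc.span (nc_e d ` set_partitions d)"
  \<comment> \<open>This bound makes the truncated measure \<open>d - card \<tau>\<close> strictly
    decrease.\<close>
  have card_le: "card \<rho> \<le> d" if "partition_on {1..d} \<rho>" for \<rho>
  proof -
    have fin: "finite B" and ne: "B \<noteq> {}" if "B \<in> \<rho>" for B
      using that \<open>partition_on {1..d} \<rho>\<close> finite_subset[of B "{1..d}"]
      by (auto dest: partition_onD1 partition_onD3)
    have "card \<rho> = (\<Sum>B\<in>\<rho>. 1)" by simp
    also have "\<dots> \<le> (\<Sum>B\<in>\<rho>. card B)"
      using fin ne by (intro sum_mono) (simp add: Suc_le_eq card_gt_0_iff)
    also have "\<dots> = card (\<Union>\<rho>)"
      using partition_onD2[OF that] fin by (intro card_Union_disjoint[symmetric])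
    finally show ?thesis using partition_onD1[OF that, symmetric] by simp
  qed
  have \<tau>: "partition_on {1..d} \<tau>" using less.prems by (simp add: set_partitions_def)
  obtain \<mu> where \<mu>: "\<mu> \<noteq> 0" "e_series d \<tau> - ncscale \<mu> (p_series d \<tau>) \<in>
      nc.span (p_series d ` {\<rho>. partition_on {1..d} \<rho> \<and> card \<tau> < card \<rho>})"
    using e_series_triangular[OF _ \<tau>, of d] by auto
  have "nc.span (p_series d ` {\<rho>. partition_on {1..d} \<rho> \<and> card \<tau> < card \<rho>}) \<subseteq> ?S"
  proof (rule nc.span_minimal[OF _ nc.subspace_span], clarify)
    fix \<rho> assume \<rho>: "partition_on {1..d} \<rho>" "card \<tau> < card \<rho>"
    with card_le[of \<rho>] show "p_series d \<rho> \<in> ?S"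
      by (intro less.hyps) (auto simp: set_partitions_def)
  qed
  with \<mu>(2) have "e_series d \<tau> - ncscale \<mu> (p_series d \<tau>) \<in> ?S" by blast
  moreover have "e_series d \<tau> \<in> ?S"
    using less.prems by (auto simp: e_series_def nc_e_eq[symmetric] intro: nc.span_base)
  ultimately have "ncscale (1 / \<mu>) (e_series d \<tau> - (e_series d \<tau> - ncscale \<mu> (p_series d \<tau>))) \<in> ?S"
    by (rule nc.span_scale[OF nc.span_diff, rotated])
  moreover have "ncscale (1 / \<mu>) (e_series d \<tau> - (e_series d \<tau> - ncscale \<mu> (p_series d \<tau>))) = p_series d \<tau>"
    using \<mu>(1) by (simp add: ncscale_def fun_eq_iff)
  ultimately show ?case by metis
qed

section \<open>Monomial basis and independence of the e\<close>

definition colour_kernel :: "nat \<Rightarrow> (nat \<Rightarrow> nat) \<Rightarrow> nat set set" where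
  "colour_kernel d \<kappa> = (\<lambda>i. {j \<in> {1..d}. \<kappa> j = \<kappa> i}) ` {1..d}"

text \<open>The monomial symmetric function m_\<sigma> in noncommuting variables.\<close>

definition m_series :: "nat \<Rightarrow> nat set set \<Rightarrow> ncseries" where
  "m_series d \<sigma> = colour_series d (\<lambda>\<kappa>. of_bool (colour_kernel d \<kappa> = \<sigma>))"

lemma finite_set_partitions: "finite (set_partitions d)"
  by (simp add: set_partitions_def finitely_many_partition_on)

lemma kernel_in_set_partitions: "colour_kernel d \<kappa> \<in> set_partitions d"
  unfolding set_partitions_def mem_Collect_eq
  by (rule partition_onI) (auto simp: colour_kernel_def disjnt_def)

lemma same_block_kernel: "(\<exists>B\<in>colour_kernel d \<kappa>. i \<in> B \<and> j \<in> B) \<longleftrightarrow> i \<in> {1..d} \<and> j \<in> {1..d} \<and> \<kappa> i = \<kappa> j"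
  by (auto simp: colour_kernel_def)

lemma ex_colouring_kernel:
  assumes "\<sigma> \<in> set_partitions d"
  obtains \<kappa> where "\<And>i. \<kappa> i \<ge> 1" and "colour_kernel d \<kappa> = \<sigma>"
proof -
  have \<sigma>: "partition_on {1..d} \<sigma>" using assms by (simp add: set_partitions_def)
  obtain g :: "nat set \<Rightarrow> nat" where g: "inj_on g \<sigma>"
    using finite_imp_inj_to_nat_seg[OF finite_elements[OF _ \<sigma>]] by auto
  define \<kappa> where "\<kappa> i = Suc (g (block \<sigma> i))" for i
  have colour_class: "{j \<in> {1..d}. \<kappa> j = \<kappa> i} = B" if "B \<in> \<sigma>" "i \<in> B" for B i
  proof (intro equalityI subsetI)
    fix j assume j: "j \<in> {j \<in> {1..d}. \<kappa> j = \<kappa> i}"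
    then obtain C where C: "C \<in> \<sigma>" "j \<in> C" using partition_onD1[OF \<sigma>] by blast
    with j g that have "C = B"
      by (auto simp: \<kappa>_def block_eq[OF \<sigma>] dest: inj_onD)
    with C show "j \<in> B" by simp
  next
    fix j assume "j \<in> B"
    with that show "j \<in> {j \<in> {1..d}. \<kappa> j = \<kappa> i}"
      using partition_onD1[OF \<sigma>] by (auto simp: \<kappa>_def block_eq[OF \<sigma>])
  qed
  have "colour_kernel d \<kappa> = \<sigma>"
  proof (intro equalityI subsetI)
    fix C assume "C \<in> colour_kernel d \<kappa>"
    then obtain i where i: "i \<in> {1..d}" "C = {j \<in> {1..d}. \<kappa> j = \<kappa> i}" by (auto simp: colour_kernel_def)
    then obtain B where "B \<in> \<sigma>" "i \<in> B" using partition_onD1[OF \<sigma>] by blast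
    with colour_class i show "C \<in> \<sigma>" by simp
  next
    fix B assume B: "B \<in> \<sigma>"
    then obtain i where i: "i \<in> B" using partition_onD3[OF \<sigma>] by fastforce
    moreover have "i \<in> {1..d}" using B i partition_onD1[OF \<sigma>] by blast
    ultimately show "B \<in> colour_kernel d \<kappa>" unfolding colour_kernel_def using colour_class[OF B i] by blast
  qed
  then show thesis by (intro that[of \<kappa>]) (simp_all add: \<kappa>_def)
qed

lemma colour_series_map:
  assumes "\<And>\<kappa> \<kappa>'. (\<And>i. i \<in> {1..d} \<Longrightarrow> \<kappa> i = \<kappa>' i) \<Longrightarrow> F \<kappa> = F \<kappa>'"
    and "\<And>i. i \<in> {1..d} \<Longrightarrow> \<kappa> i \<ge> 1"
  shows "colour_series d F (map \<kappa> [1..<d + 1]) = F \<kappa>"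
proof -
  have "(map \<kappa> [1..<d + 1]) ! (i - 1) = \<kappa> i" if "i \<in> {1..d}" for i
    using that by (subst nth_map) (auto simp del: upt_Suc)
  then have "F (\<lambda>i. map \<kappa> [1..<d + 1] ! (i - 1)) = F \<kappa>"
    by (rule assms(1))
  moreover have "0 \<notin> set (map \<kappa> [1..<d + 1])"
    using assms(2) by (fastforce simp del: upt_Suc)
  ultimately show ?thesis
    by (simp add: colour_series_def del: upt_Suc)
qed

lemma colour_kernel_cong: "(\<And>i. i \<in> {1..d} \<Longrightarrow> \<kappa> i = \<kappa>' i) \<Longrightarrow> colour_kernel d \<kappa> = colour_kernel d \<kappa>'"
  unfolding colour_kernel_def by (intro image_cong refl Collect_cong) auto

lemma colour_series_kernel:
  "colour_series d (\<lambda>\<kappa>. f (colour_kernel d \<kappa>)) = (\<Sum>\<sigma>\<in>set_partitions d. ncscale (f \<sigma>) (m_series d \<sigma>))"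
proof -
  have "f (colour_kernel d \<kappa>) = (\<Sum>\<sigma>\<in>set_partitions d. f \<sigma> * of_bool (colour_kernel d \<kappa> = \<sigma>))" for \<kappa>
  proof -
    have "(\<Sum>\<sigma>\<in>set_partitions d. f \<sigma> * of_bool (colour_kernel d \<kappa> = \<sigma>)) =
        (\<Sum>\<sigma>\<in>set_partitions d. if colour_kernel d \<kappa> = \<sigma> then f \<sigma> else 0)"
      by (intro sum.cong) auto
    then show ?thesis
      by (simp add: finite_set_partitions kernel_in_set_partitions)
  qed
  then show ?thesis
    unfolding m_series_def colour_series_scale[symmetric] colour_series_sum[symmetric] by presburger
qed

text \<open>A colouring is constant on the blocks of \<sigma> exactly when \<sigma> refines its
  kernel.\<close>

lemma p_series_eq_sum_m:
  assumes "\<sigma> \<in> set_partitions d"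
  shows "p_series d \<sigma> = (\<Sum>\<tau>\<in>{\<tau>. refines {1..d} \<sigma> \<tau>}. m_series d \<tau>)"
proof -
  have \<sigma>: "partition_on {1..d} \<sigma>" using assms by (simp add: set_partitions_def)
  have const: "constant_on_blocks \<sigma> \<kappa> \<longleftrightarrow> refines {1..d} \<sigma> (colour_kernel d \<kappa>)" for \<kappa>
  proof -
    have "(\<forall>i\<in>B. \<forall>j\<in>B. \<kappa> i = \<kappa> j) \<longleftrightarrow> (\<exists>C\<in>colour_kernel d \<kappa>. B \<subseteq> C)" if B: "B \<in> \<sigma>" for B
    proof
      assume *: "\<forall>i\<in>B. \<forall>j\<in>B. \<kappa> i = \<kappa> j"
      obtain i where i: "i \<in> B" using B partition_onD3[OF \<sigma>] by fastforce
      have sub: "B \<subseteq> {1..d}" using B partition_onD1[OF \<sigma>] by blast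
      have "B \<subseteq> {j \<in> {1..d}. \<kappa> j = \<kappa> i}" using * i sub by blast
      moreover have "{j \<in> {1..d}. \<kappa> j = \<kappa> i} \<in> colour_kernel d \<kappa>"
        unfolding colour_kernel_def using i sub by blast
      ultimately show "\<exists>C\<in>colour_kernel d \<kappa>. B \<subseteq> C" by blast
    next
      assume "\<exists>C\<in>colour_kernel d \<kappa>. B \<subseteq> C"
      then obtain i where "B \<subseteq> {j \<in> {1..d}. \<kappa> j = \<kappa> i}" unfolding colour_kernel_def by blast
      then have "\<kappa> j = \<kappa> i" if "j \<in> B" for j using that by blast
      then show "\<forall>i\<in>B. \<forall>j\<in>B. \<kappa> i = \<kappa> j" by simp
    qed
    then show ?thesis
      using \<sigma> kernel_in_set_partitions[of d \<kappa>]
      by (simp add: constant_on_blocks_def refines_def set_partitions_def)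
  qed
  have "p_series d \<sigma> = (\<Sum>\<tau>\<in>set_partitions d. ncscale (of_bool (refines {1..d} \<sigma> \<tau>)) (m_series d \<tau>))"
    unfolding p_series_def const by (rule colour_series_kernel)
  also have "\<dots> = (\<Sum>\<tau>\<in>{\<tau>. refines {1..d} \<sigma> \<tau>}. m_series d \<tau>)"
    by (rule sum.mono_neutral_cong_right)
      (use finite_set_partitions in \<open>auto simp: refines_def set_partitions_def ncscale_def\<close>)
  finally show ?thesis .
qed

text \<open>Moebius inversion over refinement, as an induction: a strictly coarser \<tau> has fewer
  coarsenings than \<sigma>, and subtracting all these m_\<tau> from p_\<sigma> leaves
  m_\<sigma>.\<close>

lemma m_series_in_span_e:
  assumes "\<sigma> \<in> set_partitions d"
  shows "m_series d \<sigma> \<in> nc.span (nc_e d ` set_partitions d)"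
  using assms
proof (induction "card {\<tau>. refines {1..d} \<sigma> \<tau>}" arbitrary: \<sigma> rule: less_induct)
  case less
  let ?S = "nc.span (nc_e d ` set_partitions d)"
  let ?R = "\<lambda>\<sigma>. {\<tau>. refines {1..d} \<sigma> \<tau>}"
  have fin: "finite (?R \<tau>)" for \<tau>
    by (rule finite_subset[OF _ finite_set_partitions[of d]]) (auto simp: refines_def set_partitions_def)
  have \<sigma>: "\<sigma> \<in> ?R \<sigma>" using less.prems by (simp add: refines_refl set_partitions_def)
  have "m_series d \<tau> \<in> ?S" if \<tau>: "\<tau> \<in> ?R \<sigma> - {\<sigma>}" for \<tau>
  proof (rule less.hyps)
    have "?R \<tau> \<subseteq> ?R \<sigma>" "\<sigma> \<notin> ?R \<tau>"
      using \<tau> refines_trans refines_asym by blast+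
    then have "?R \<tau> \<subset> ?R \<sigma>" using \<sigma> by blast
    then show "card (?R \<tau>) < card (?R \<sigma>)" by (rule psubset_card_mono[OF fin])
    show "\<tau> \<in> set_partitions d" using \<tau> by (auto simp: refines_def set_partitions_def)
  qed
  then have "p_series d \<sigma> - (\<Sum>\<tau>\<in>?R \<sigma> - {\<sigma>}. m_series d \<tau>) \<in> ?S"
    using less.prems by (intro nc.span_diff[OF p_series_in_span_e] nc.span_sum)
  also have "p_series d \<sigma> - (\<Sum>\<tau>\<in>?R \<sigma> - {\<sigma>}. m_series d \<tau>) = m_series d \<sigma>"
    unfolding p_series_eq_sum_m[OF less.prems] sum.remove[OF fin \<sigma>] by simp
  finally show ?case .
qed

lemma m_series_map:
  assumes "\<And>i. \<kappa> i \<ge> 1"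
  shows "m_series d \<sigma> (map \<kappa> [1..<d + 1]) = of_bool (colour_kernel d \<kappa> = \<sigma>)"
  unfolding m_series_def
proof (rule colour_series_map)
  fix \<kappa> \<kappa>' :: "nat \<Rightarrow> nat" assume "\<And>i. i \<in> {1..d} \<Longrightarrow> \<kappa> i = \<kappa>' i"
  then have "colour_kernel d \<kappa> = colour_kernel d \<kappa>'" by (rule colour_kernel_cong)
  then show "(of_bool (colour_kernel d \<kappa> = \<sigma>) :: rat) = of_bool (colour_kernel d \<kappa>' = \<sigma>)" by simp
qed (rule assms)

lemma inj_on_m_series: "inj_on (m_series d) (set_partitions d)"
proof (rule inj_onI)
  fix \<sigma> \<tau> assume "\<sigma> \<in> set_partitions d" and eq: "m_series d \<sigma> = m_series d \<tau>"
  then obtain \<kappa> where \<kappa>: "\<And>i. \<kappa> i \<ge> 1" "colour_kernel d \<kappa> = \<sigma>" using ex_colouring_kernel by metis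
  show "\<sigma> = \<tau>"
    using fun_cong[OF eq, of "map \<kappa> [1..<d + 1]"] \<kappa>(2)
    unfolding m_series_map[OF \<kappa>(1)] by (simp split: if_splits)
qed

text \<open>A word whose letters repeat exactly along \<sigma> occurs in m_\<sigma> and in no other
  m_\<tau>, so its coefficient isolates one scalar.\<close>

lemma independent_m_series: "nc.independent (m_series d ` set_partitions d)"
proof (rule nc.independent_if_scalars_zero)
  fix f x
  assume sum: "(\<Sum>x\<in>m_series d ` set_partitions d. ncscale (f x) x) = 0"
    and "x \<in> m_series d ` set_partitions d"
  then obtain \<sigma> where \<sigma>: "\<sigma> \<in> set_partitions d" "x = m_series d \<sigma>" by blast
  then obtain \<kappa> where \<kappa>: "\<And>i. \<kappa> i \<ge> 1" "colour_kernel d \<kappa> = \<sigma>" using ex_colouring_kernel by metis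
  have "(\<Sum>\<tau>\<in>set_partitions d. ncscale (f (m_series d \<tau>)) (m_series d \<tau>)) = 0"
    using sum by (simp add: sum.reindex[OF inj_on_m_series])
  then have "colour_series d (\<lambda>\<kappa>. f (m_series d (colour_kernel d \<kappa>))) (map \<kappa> [1..<d + 1]) = 0"
    unfolding colour_series_kernel[of d "\<lambda>\<tau>. f (m_series d \<tau>)"] by simp
  also have "colour_series d (\<lambda>\<kappa>. f (m_series d (colour_kernel d \<kappa>))) (map \<kappa> [1..<d + 1]) = f x"
    unfolding \<sigma> \<kappa>(2)[symmetric]
  proof (rule colour_series_map)
    fix \<kappa> \<kappa>' :: "nat \<Rightarrow> nat" assume "\<And>i. i \<in> {1..d} \<Longrightarrow> \<kappa> i = \<kappa>' i"
    then have "colour_kernel d \<kappa> = colour_kernel d \<kappa>'" by (rule colour_kernel_cong)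
    then show "f (m_series d (colour_kernel d \<kappa>)) = f (m_series d (colour_kernel d \<kappa>'))" by simp
  qed (rule \<kappa>(1))
  finally show "f x = 0" .
qed (simp add: finite_set_partitions)

text \<open>The m_\<sigma> are independent, one per set partition, and lie in the span of the
  e_\<pi>. So a maximal independent subfamily of the e_\<pi> has at least as many members as there
  are set partitions, which leaves room neither for a dependency nor for a repetition.\<close>

lemma nc_e_basis:
  shows independent_nc_e: "nc.independent (nc_e d ` set_partitions d)"
    and inj_on_nc_e: "inj_on (nc_e d) (set_partitions d)"
proof -
  let ?P = "set_partitions d" and ?E = "nc_e d ` set_partitions d"
  obtain B where B: "B \<subseteq> ?E" "nc.independent B" "?E \<subseteq> nc.span B"
    using nc.maximal_independent_subset[of ?E] by blast
  have fin: "finite ?E" "finite B"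
    using finite_subset[OF B(1)] by (simp_all add: finite_set_partitions)
  have "m_series d ` ?P \<subseteq> nc.span ?E" using m_series_in_span_e by blast
  also have "\<dots> \<subseteq> nc.span B" using B(3) by (intro nc.span_minimal nc.subspace_span)
  finally have "card (m_series d ` ?P) \<le> card B"
    using nc.independent_span_bound[OF fin(2) independent_m_series] by blast
  then have "card ?P \<le> card B" by (simp add: card_image[OF inj_on_m_series])
  moreover have "card B \<le> card ?E" using B(1) fin by (intro card_mono)
  moreover have "card ?E \<le> card ?P" by (intro card_image_le finite_set_partitions)
  ultimately have "card B = card ?E" "card ?E = card ?P" by linarith+
  then show "inj_on (nc_e d) ?P" "nc.independent ?E"
    using B card_subset_eq[OF fin(1) B(1)] eq_card_imp_inj_on[OF finite_set_partitions] by auto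
qed

section \<open>Coordinates with respect to the e\<close>

lemma kernel_series_in_span_e:
  assumes "\<And>\<kappa>. F \<kappa> = f (colour_kernel d \<kappa>)"
  shows "colour_series d F \<in> nc.span (nc_e d ` set_partitions d)"
proof -
  have "F = (\<lambda>\<kappa>. f (colour_kernel d \<kappa>))" using assms by blast
  then show ?thesis
    by (simp add: colour_series_kernel nc.span_sum nc.span_scale m_series_in_span_e)
qed

lemma graph_series_in_span_e:
  assumes "E \<subseteq> complete_graph d"
  shows "colour_series d (\<lambda>\<kappa>. of_bool (\<forall>i j. {i, j} \<in> E \<longrightarrow> \<kappa> i \<noteq> \<kappa> j)) \<in> nc.span (nc_e d ` set_partitions d)"
proof (rule kernel_series_in_span_e)
  fix \<kappa> :: "nat \<Rightarrow> nat"
  have "i \<in> {1..d} \<and> j \<in> {1..d}" if "{i, j} \<in> E" for i j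
    using that assms by (auto simp: complete_graph_def doubleton_eq_iff)
  then have "(\<forall>i j. {i, j} \<in> E \<longrightarrow> \<kappa> i \<noteq> \<kappa> j) \<longleftrightarrow> (\<forall>i j. {i, j} \<in> E \<longrightarrow> \<not> (\<exists>B\<in>colour_kernel d \<kappa>. i \<in> B \<and> j \<in> B))"
    unfolding same_block_kernel by blast
  then show "of_bool (\<forall>i j. {i, j} \<in> E \<longrightarrow> \<kappa> i \<noteq> \<kappa> j) =
      (\<lambda>\<sigma>. of_bool (\<forall>i j. {i, j} \<in> E \<longrightarrow> \<not> (\<exists>B\<in>\<sigma>. i \<in> B \<and> j \<in> B))) (colour_kernel d \<kappa>)"
    by simp
qed

lemma span_nc_e_expansion:
  assumes "f \<in> nc.span (nc_e d ` set_partitions d)"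
  obtains c where "f = (\<Sum>\<pi>\<in>set_partitions d. ncscale (c \<pi>) (nc_e d \<pi>))"
proof -
  obtain u where "f = (\<Sum>v\<in>nc_e d ` set_partitions d. ncscale (u v) v)"
    using assms by (auto simp: nc.span_finite finite_set_partitions)
  then show thesis
    by (intro that[of "\<lambda>\<pi>. u (nc_e d \<pi>)"]) (simp add: sum.reindex[OF inj_on_nc_e])
qed

text \<open>Linearity of \<open>nu\<close> is available on the span, since
  \<open>nc.representation\<close> is 0 outside it; every later use must therefore place its series
  in the span.\<close>

lemma lookup_nu_sum:
  assumes "\<And>i. i \<in> I \<Longrightarrow> f i \<in> nc.span (nc_e d ` set_partitions d)"
  shows "Poly_Mapping.lookup (nu d (\<Sum>i\<in>I. ncscale (a i) (f i))) t =
    (\<Sum>i\<in>I. a i * Poly_Mapping.lookup (nu d (f i)) t)"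
proof -
  let ?rep = "nc.representation (nc_e d ` set_partitions d)"
  have "?rep (\<Sum>i\<in>I. ncscale (a i) (f i)) = (\<lambda>b. \<Sum>i\<in>I. ?rep (ncscale (a i) (f i)) b)"
    using assms by (intro nc.representation_sum independent_nc_e nc.span_scale)
  also have "\<dots> = (\<lambda>b. \<Sum>i\<in>I. a i * ?rep (f i) b)"
    using assms by (simp add: nc.representation_scale[OF independent_nc_e])
  finally have "Poly_Mapping.lookup (nu d (\<Sum>i\<in>I. ncscale (a i) (f i))) t =
      (\<Sum>\<pi>\<in>set_partitions d. \<Sum>i\<in>I. a i * (?rep (f i) (nc_e d \<pi>) when partition_type d \<pi> = t))"
    by (auto simp: nu_def lookup_sum lookup_single when_def intro!: sum.cong)
  also have "\<dots> = (\<Sum>i\<in>I. \<Sum>\<pi>\<in>set_partitions d. a i * (?rep (f i) (nc_e d \<pi>) when partition_type d \<pi> = t))"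
    by (rule sum.swap)
  also have "\<dots> = (\<Sum>i\<in>I. a i * Poly_Mapping.lookup (nu d (f i)) t)"
    by (simp add: nu_def lookup_sum lookup_single sum_distrib_left)
  finally show ?thesis .
qed

lemma lookup_nu_nc_e:
  assumes "\<pi> \<in> set_partitions d"
  shows "Poly_Mapping.lookup (nu d (nc_e d \<pi>)) t = of_bool (partition_type d \<pi> = t)"
proof -
  have "nc.representation (nc_e d ` set_partitions d) (nc_e d \<pi>) (nc_e d \<rho>) = (if \<rho> = \<pi> then 1 else 0)"
    if "\<rho> \<in> set_partitions d" for \<rho>
    using assms that inj_on_nc_e by (auto simp: nc.representation_basis[OF independent_nc_e] dest: inj_onD)
  then have "Poly_Mapping.lookup (nu d (nc_e d \<pi>)) t =
      (\<Sum>\<rho>\<in>set_partitions d. if \<rho> = \<pi> then of_bool (partition_type d \<pi> = t) else 0)"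
    unfolding nu_def lookup_sum lookup_single by (intro sum.cong) (auto simp: when_def)
  then show ?thesis
    using assms by (simp add: finite_set_partitions)
qed

lemma lookup_nu_expansion:
  "Poly_Mapping.lookup (nu d (\<Sum>\<pi>\<in>set_partitions d. ncscale (c \<pi>) (nc_e d \<pi>))) t =
    (\<Sum>\<pi>\<in>set_partitions d. c \<pi> * of_bool (partition_type d \<pi> = t))"
  by (subst lookup_nu_sum) (simp_all add: nc.span_base lookup_nu_nc_e)

section \<open>Relabelling\<close>

lemma injective_on_blocks_cong:
  assumes "\<Union>\<B> \<subseteq> A" and "\<And>i. i \<in> A \<Longrightarrow> \<kappa> i = \<kappa>' i"
  shows "injective_on_blocks \<B> \<kappa> = injective_on_blocks \<B> \<kappa>'"
  unfolding injective_on_blocks_def using assms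
  by (intro ball_cong refl inj_on_cong) blast

lemma e_series_in_span:
  assumes "\<Union>\<B> \<subseteq> {1..d}"
  shows "e_series d \<B> \<in> nc.span (nc_e d ` set_partitions d)"
  unfolding e_series_def
proof (rule kernel_series_in_span_e)
  fix \<kappa> :: "nat \<Rightarrow> nat"
  have "inj_on \<kappa> B \<longleftrightarrow> (\<forall>i\<in>B. \<forall>j\<in>B. i \<noteq> j \<longrightarrow> \<not> (\<exists>C\<in>colour_kernel d \<kappa>. i \<in> C \<and> j \<in> C))" if "B \<in> \<B>" for B
  proof -
    have "B \<subseteq> {1..d}" using that assms by blast
    then show ?thesis unfolding same_block_kernel inj_on_def by blast
  qed
  then show "of_bool (injective_on_blocks \<B> \<kappa>) =
      (\<lambda>\<sigma>. of_bool (\<forall>B\<in>\<B>. \<forall>i\<in>B. \<forall>j\<in>B. i \<noteq> j \<longrightarrow> \<not> (\<exists>C\<in>\<sigma>. i \<in> C \<and> j \<in> C))) (colour_kernel d \<kappa>)"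
    by (simp add: injective_on_blocks_def)
qed

text \<open>Undoes the passage to series: an expansion becomes an identity of functions, into which
  other colourings can be substituted, such as \<kappa> composed with a permutation or a colouring
  of a larger vertex set.\<close>

lemma nc_e_expansion_pointwise:
  assumes F: "\<And>\<kappa> \<kappa>'. (\<And>i. i \<in> {1..d} \<Longrightarrow> \<kappa> i = \<kappa>' i) \<Longrightarrow> F \<kappa> = F \<kappa>'"
    and c: "colour_series d F = (\<Sum>\<pi>\<in>set_partitions d. ncscale (c \<pi>) (nc_e d \<pi>))"
    and \<kappa>: "\<And>i. i \<in> {1..d} \<Longrightarrow> \<kappa> i \<ge> 1"
  shows "F \<kappa> = (\<Sum>\<pi>\<in>set_partitions d. c \<pi> * of_bool (injective_on_blocks \<pi> \<kappa>))"
proof -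
  have "F \<kappa> = colour_series d F (map \<kappa> [1..<d + 1])"
    using F \<kappa> by (rule colour_series_map[symmetric])
  also have "\<dots> = (\<Sum>\<pi>\<in>set_partitions d. c \<pi> * nc_e d \<pi> (map \<kappa> [1..<d + 1]))"
    unfolding c sum_series_apply ncscale_def ..
  also have "\<dots> = (\<Sum>\<pi>\<in>set_partitions d. c \<pi> * of_bool (injective_on_blocks \<pi> \<kappa>))"
  proof (rule sum.cong[OF refl])
    fix \<pi> assume \<pi>: "\<pi> \<in> set_partitions d"
    then have "\<Union>\<pi> \<subseteq> {1..d}" by (auto simp: set_partitions_def partition_on_def)
    then have "nc_e d \<pi> (map \<kappa> [1..<d + 1]) = of_bool (injective_on_blocks \<pi> \<kappa>)"
      unfolding nc_e_eq[OF \<pi>] by (intro colour_series_map \<kappa> arg_cong[where f = of_bool] injective_on_blocks_cong)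
    then show "c \<pi> * nc_e d \<pi> (map \<kappa> [1..<d + 1]) = c \<pi> * of_bool (injective_on_blocks \<pi> \<kappa>)" by simp
  qed
  finally show ?thesis .
qed

lemma colour_series_cong:
  assumes "\<And>\<kappa>. (\<And>i. i \<in> {1..d} \<Longrightarrow> \<kappa> i \<ge> 1) \<Longrightarrow> F \<kappa> = F' \<kappa>"
  shows "colour_series d F = colour_series d F'"
proof
  fix w
  show "colour_series d F w = colour_series d F' w"
  proof (cases "length w = d \<and> 0 \<notin> set w")
    case True
    have "w ! (i - 1) \<ge> 1" if "i \<in> {1..d}" for i
    proof -
      have "w ! (i - 1) \<in> set w" using that True by (intro nth_mem) auto
      then have "w ! (i - 1) \<noteq> 0" using True by metis
      then show ?thesis by simp
    qed
    then have "F (\<lambda>i. w ! (i - 1)) = F' (\<lambda>i. w ! (i - 1))" by (rule assms)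
    then show ?thesis by (simp add: colour_series_def)
  qed (auto simp: colour_series_def)
qed

lemma partition_type_eq:
  assumes "\<pi> \<in> set_partitions d" and "B \<in> \<pi>" and "d \<in> B"
  shows "partition_type d \<pi> = (image_mset card (mset_set (\<pi> - {B})), card B)"
  using assms by (simp add: partition_type_def set_partitions_def block_eq)

lemma partition_relabel:
  assumes \<pi>: "\<pi> \<in> set_partitions d" and \<delta>: "bij_betw \<delta> {1..d} {1..d}"
  shows "(`) \<delta> ` \<pi> \<in> set_partitions d"
proof -
  have p: "partition_on {1..d} \<pi>" using \<pi> by (simp add: set_partitions_def)
  have "partition_on (\<delta> ` {1..d}) ((`) \<delta> ` \<pi> - {{}})"
    by (rule partition_on_inj_image[OF p bij_betw_imp_inj_on[OF \<delta>]])
  moreover have "(`) \<delta> ` \<pi> - {{}} = (`) \<delta> ` \<pi>"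
    using partition_onD3[OF p] by auto
  ultimately show ?thesis
    unfolding bij_betw_imp_surj_on[OF \<delta>] set_partitions_def by simp
qed

lemma partition_type_relabel:
  assumes \<pi>: "\<pi> \<in> set_partitions d" and \<delta>: "bij_betw \<delta> {1..d} {1..d}" "\<delta> d = d" and "d \<ge> 1"
  shows "partition_type d ((`) \<delta> ` \<pi>) = partition_type d \<pi>"
proof -
  have p: "partition_on {1..d} \<pi>" using \<pi> by (simp add: set_partitions_def)
  have inj: "inj_on \<delta> {1..d}" by (rule bij_betw_imp_inj_on[OF \<delta>(1)])
  have sub: "C \<subseteq> {1..d}" if "C \<in> \<pi>" for C
    using that partition_onD1[OF p] by blast
  have "d \<in> \<Union>\<pi>" using partition_onD1[OF p] \<open>d \<ge> 1\<close> by auto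
  then obtain B where B: "B \<in> \<pi>" "d \<in> B" by blast
  then have B': "\<delta> ` B \<in> (`) \<delta> ` \<pi>" "d \<in> \<delta> ` B" using \<delta>(2) by (auto intro: rev_image_eqI)
  have inj': "inj_on ((`) \<delta>) \<pi>"
    using inj sub by (intro inj_onI) (metis inj_on_image_eq_iff)
  have "(`) \<delta> ` \<pi> - {\<delta> ` B} = (`) \<delta> ` (\<pi> - {B})"
    using inj_on_image_set_diff[OF inj', of \<pi> "{B}"] B by simp
  then have "image_mset card (mset_set ((`) \<delta> ` \<pi> - {\<delta> ` B})) =
      image_mset card (image_mset ((`) \<delta>) (mset_set (\<pi> - {B})))"
    using inj_on_subset[OF inj', of "\<pi> - {B}"] by (simp add: image_mset_mset_set)
  also have "\<dots> = image_mset card (mset_set (\<pi> - {B}))"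
    using finite_elements[OF _ p] card_image[OF inj_on_subset[OF inj sub]] unfolding multiset.map_comp
    by (intro image_mset_cong) auto
  finally show ?thesis
    unfolding partition_type_eq[OF \<pi> B] partition_type_eq[OF partition_relabel[OF \<pi> \<delta>(1)] B']
    using card_image[OF inj_on_subset[OF inj sub[OF B(1)]]] by simp
qed

text \<open>Substituting \<kappa> composed with \<delta> into the expansion of the original series
  gives the expansion of the relabelled one, each e_\<pi> being replaced by its relabelling, which
  has the same type. The blocks may overlap, so this covers unions of cliques.\<close>

lemma nu_e_series_relabel:
  assumes \<B>: "\<Union>\<B> \<subseteq> {1..d}" and \<delta>: "bij_betw \<delta> {1..d} {1..d}" "\<delta> d = d" and "d \<ge> 1"
  shows "Poly_Mapping.lookup (nu d (e_series d ((`) \<delta> ` \<B>))) t = Poly_Mapping.lookup (nu d (e_series d \<B>)) t"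
proof -
  obtain c where c: "e_series d \<B> = (\<Sum>\<pi>\<in>set_partitions d. ncscale (c \<pi>) (nc_e d \<pi>))"
    using span_nc_e_expansion[OF e_series_in_span[OF \<B>]] .
  have relabel: "injective_on_blocks ((`) \<delta> ` \<C>) \<kappa> \<longleftrightarrow> injective_on_blocks \<C> (\<kappa> \<circ> \<delta>)"
    if "\<Union>\<C> \<subseteq> {1..d}" for \<C> and \<kappa> :: "nat \<Rightarrow> nat"
  proof -
    have "inj_on \<kappa> (\<delta> ` C) \<longleftrightarrow> inj_on (\<kappa> \<circ> \<delta>) C" if "C \<in> \<C>" for C
    proof (rule comp_inj_on_iff)
      show "inj_on \<delta> C"
        by (rule inj_on_subset[OF bij_betw_imp_inj_on[OF \<delta>(1)]]) (use that \<open>\<Union>\<C> \<subseteq> {1..d}\<close> in blast)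
    qed
    then show ?thesis by (simp add: injective_on_blocks_def)
  qed
  have sub: "\<Union>\<pi> \<subseteq> {1..d}" if "\<pi> \<in> set_partitions d" for \<pi>
    using that by (simp add: set_partitions_def partition_on_def)
  have "e_series d ((`) \<delta> ` \<B>) =
      colour_series d (\<lambda>\<kappa>. \<Sum>\<pi>\<in>set_partitions d. c \<pi> * of_bool (injective_on_blocks ((`) \<delta> ` \<pi>) \<kappa>))"
    unfolding e_series_def
  proof (rule colour_series_cong)
    fix \<kappa> :: "nat \<Rightarrow> nat" assume "\<And>i. i \<in> {1..d} \<Longrightarrow> \<kappa> i \<ge> 1"
    then have "\<And>i. i \<in> {1..d} \<Longrightarrow> (\<kappa> \<circ> \<delta>) i \<ge> 1"
      using bij_betwE[OF \<delta>(1)] unfolding comp_def by blast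
    then have "of_bool (injective_on_blocks \<B> (\<kappa> \<circ> \<delta>)) =
        (\<Sum>\<pi>\<in>set_partitions d. c \<pi> * of_bool (injective_on_blocks \<pi> (\<kappa> \<circ> \<delta>)))"
      using c[unfolded e_series_def] \<B>
      by (intro nc_e_expansion_pointwise arg_cong[where f = of_bool] injective_on_blocks_cong)
    then show "of_bool (injective_on_blocks ((`) \<delta> ` \<B>) \<kappa>) =
        (\<Sum>\<pi>\<in>set_partitions d. c \<pi> * of_bool (injective_on_blocks ((`) \<delta> ` \<pi>) \<kappa>))"
      using relabel[OF \<B>] relabel[OF sub] by simp
  qed
  also have "\<dots> = (\<Sum>\<pi>\<in>set_partitions d. ncscale (c \<pi>) (nc_e d ((`) \<delta> ` \<pi>)))"
    unfolding colour_series_sum colour_series_scale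
    using partition_relabel[OF _ \<delta>(1)] by (simp add: nc_e_eq)
  finally have "Poly_Mapping.lookup (nu d (e_series d ((`) \<delta> ` \<B>))) t =
      (\<Sum>\<pi>\<in>set_partitions d. c \<pi> * of_bool (partition_type d ((`) \<delta> ` \<pi>) = t))"
    using partition_relabel[OF _ \<delta>(1)] by (simp add: lookup_nu_sum nc.span_base lookup_nu_nc_e)
  also have "\<dots> = Poly_Mapping.lookup (nu d (e_series d \<B>)) t"
    unfolding c lookup_nu_expansion using partition_type_relabel[OF _ \<delta> \<open>d \<ge> 1\<close>] by simp
  finally show ?thesis .
qed

section \<open>Appending twin peaks\<close>

definition configurations :: "nat set \<Rightarrow> nat \<Rightarrow> (nat set \<times> nat) set" where
  "configurations S a = {(A, v). v \<in> S \<and> A \<subseteq> S - {v} \<and> card A = a}"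

text \<open>R holds the blocks that the gluing does not touch. The others overlap, in v and in the
  vertices common to the two cliques of the twin peaks graph.\<close>

definition peak_blocks :: "nat set set \<Rightarrow> nat set \<Rightarrow> nat \<Rightarrow> nat set \<Rightarrow> nat \<Rightarrow> nat set set" where
  "peak_blocks R S d A v = R \<union> {insert v A, S - A, insert d (S - A - {v})}"

lemma finite_configurations: "finite S \<Longrightarrow> finite (configurations S a)"
  by (rule finite_subset[of _ "Pow S \<times> S"]) (auto simp: configurations_def)

lemma card_configurations:
  assumes "finite S"
  shows "card (configurations S a) = card S * (card S - 1 choose a)"
proof -
  have "bij_betw (\<lambda>(A, v). (v, A)) (configurations S a) (SIGMA v:S. {A. A \<subseteq> S - {v} \<and> card A = a})"
    by (rule bij_betwI[where g = "\<lambda>(v, A). (A, v)"]) (auto simp: configurations_def)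
  then have "card (configurations S a) = card (SIGMA v:S. {A. A \<subseteq> S - {v} \<and> card A = a})"
    by (rule bij_betw_same_card)
  also have "\<dots> = (\<Sum>v\<in>S. card {A. A \<subseteq> S - {v} \<and> card A = a})"
    using assms by (intro card_SigmaI) (auto intro: finite_subset[of _ "Pow S"])
  also have "\<dots> = (\<Sum>v\<in>S. card S - 1 choose a)"
    using assms by (intro sum.cong refl) (simp add: n_subsets)
  finally show ?thesis by simp
qed

lemma sum_Pow_card:
  fixes f :: "nat \<Rightarrow> 'a :: comm_semiring_1"
  assumes "finite S"
  shows "(\<Sum>L\<in>Pow S. f (card L)) = (\<Sum>l\<le>card S. of_nat (card S choose l) * f l)"
proof -
  have "(\<Sum>L\<in>Pow S. f (card L)) = (\<Sum>l\<le>card S. \<Sum>L\<in>{L \<in> Pow S. card L = l}. f (card L))"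
    using assms by (intro sum.group[symmetric]) (auto intro: card_mono)
  also have "\<dots> = (\<Sum>l\<le>card S. of_nat (card S choose l) * f l)"
    using assms by (simp add: n_subsets)
  finally show ?thesis .
qed

text \<open>Both sides carry the factor for injectivity on R; what remains for each colouring is
  \<open>card_peaks\<close>.\<close>

lemma sum_peak_blocks:
  assumes S: "finite S" "d \<notin> S" "card S = a + n" "n \<ge> 1"
  shows "(\<Sum>(A, v)\<in>configurations S a. e_series d (peak_blocks R S d A v)) =
    (\<Sum>L\<in>Pow S. ncscale (of_int (weight a n (card L))) (e_series d (R \<union> {insert d L, S - L})))"
proof -
  have "(\<Sum>(A, v)\<in>configurations S a. of_bool (injective_on_blocks (peak_blocks R S d A v) \<kappa>)) =
      (\<Sum>L\<in>Pow S. of_int (weight a n (card L)) * of_bool (injective_on_blocks (R \<union> {insert d L, S - L}) \<kappa>) :: rat)"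
    for \<kappa> :: "nat \<Rightarrow> nat"
  proof -
    let ?r = "of_bool (injective_on_blocks R \<kappa>) :: rat"
    have peak: "of_bool (injective_on_blocks (peak_blocks R S d A v) \<kappa>) = ?r * of_bool ((A, v) \<in> peaks \<kappa> S d a)"
      if "(A, v) \<in> configurations S a" for A v
      using that by (auto simp: peak_blocks_def injective_on_blocks_def peaks_def configurations_def)
    have "(\<Sum>(A, v)\<in>configurations S a. of_bool (injective_on_blocks (peak_blocks R S d A v) \<kappa>)) =
        (\<Sum>p\<in>configurations S a. ?r * of_bool (p \<in> peaks \<kappa> S d a))"
      by (intro sum.cong refl) (auto simp only: peak split: prod.splits)
    also have "\<dots> = ?r * of_nat (card (peaks \<kappa> S d a))"
    proof -
      have "configurations S a \<inter> {p. p \<in> peaks \<kappa> S d a} = peaks \<kappa> S d a"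
        by (auto simp: configurations_def peaks_def)
      then show ?thesis
        by (simp add: sum_distrib_left[symmetric] sum_of_bool_eq finite_configurations[OF S(1)])
    qed
    also have "of_nat (card (peaks \<kappa> S d a)) = (of_int (int (card (peaks \<kappa> S d a))) :: rat)" by simp
    also have "?r * \<dots> = (\<Sum>L\<in>Pow S. of_int (weight a n (card L)) *
        (?r * of_bool (inj_on \<kappa> (insert d L) \<and> inj_on \<kappa> (S - L))))"
      unfolding card_peaks[OF S] of_int_sum sum_distrib_left of_int_mult of_int_of_bool
      by (intro sum.cong refl) (rule mult.left_commute)
    also have "\<dots> = (\<Sum>L\<in>Pow S. of_int (weight a n (card L)) *
        of_bool (injective_on_blocks (R \<union> {insert d L, S - L}) \<kappa>))"
      unfolding injective_on_blocks_def
      by (intro sum.cong refl arg_cong2[where f = "(*)"]) auto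
    finally show ?thesis .
  qed
  then have "colour_series d (\<lambda>\<kappa>. \<Sum>p\<in>configurations S a.
      of_bool (injective_on_blocks (peak_blocks R S d (fst p) (snd p)) \<kappa>)) =
    colour_series d (\<lambda>\<kappa>. \<Sum>L\<in>Pow S. of_int (weight a n (card L)) *
      of_bool (injective_on_blocks (R \<union> {insert d L, S - L}) \<kappa>))"
    by (simp only: split_def)
  then show ?thesis
    unfolding colour_series_sum colour_series_scale e_series_def split_def .
qed

text \<open>Two placements differ by a permutation of S matching A with A', v with v', and the
  remaining vertices, equally many in both. It fixes d and every vertex of X, hence the blocks in
  R.\<close>

lemma nu_peak_blocks_eq:
  assumes V: "{1..d} = X \<union> insert d S" "d \<notin> X" "X \<inter> S = {}" "d \<notin> S" "d \<ge> 1" "\<Union>R = X"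
    and Av: "(A, v) \<in> configurations S a" and Av': "(A', v') \<in> configurations S a"
  shows "Poly_Mapping.lookup (nu d (e_series d (peak_blocks R S d A' v'))) t =
    Poly_Mapping.lookup (nu d (e_series d (peak_blocks R S d A v))) t"
proof -
  define C where "C = S - A - {v}"
  define C' where "C' = S - A' - {v'}"
  have finS: "finite S"
    using finite_subset[of S "{1..d}"] V(1) by auto
  have A: "A \<subseteq> S" "v \<in> S" "v \<notin> A" "card A = a" and A': "A' \<subseteq> S" "v' \<in> S" "v' \<notin> A'" "card A' = a"
    using Av Av' by (auto simp: configurations_def)
  have fin: "finite A" "finite A'" "finite C" "finite C'"
    using A A' finS finite_subset by (auto simp: C_def C'_def)
  have "card C = card S - a - 1" "card C' = card S - a - 1"
    using A A' fin finS by (simp_all add: C_def C'_def card_Diff_subset)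
  then obtain f h where f: "bij_betw f A A'" and h: "bij_betw h C C'"
    using fin A A' finite_same_card_bij[of A A'] finite_same_card_bij[of C C'] by auto
  define \<delta> where "\<delta> i = (if i \<in> A then f i else if i \<in> C then h i else if i = v then v' else i)" for i
  have dA: "bij_betw \<delta> A A'"
    using f by (rule bij_betw_cong[THEN iffD1, rotated]) (simp add: \<delta>_def)
  have dC: "bij_betw \<delta> C C'"
    using h by (rule bij_betw_cong[THEN iffD1, rotated]) (auto simp: \<delta>_def C_def)
  have dv: "\<delta> v = v'" using A by (simp add: \<delta>_def C_def)
  have out: "\<delta> i = i" if "i \<notin> S" for i
    using that A by (auto simp: \<delta>_def C_def)
  have S: "S = A \<union> (insert v C)" "S = A' \<union> (insert v' C')" "S - A = insert v C" "S - A' = insert v' C'"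
    using A A' by (auto simp: C_def C'_def)
  have "bij_betw \<delta> (insert v C) (insert v' C')"
    using bij_betw_combine[OF _ dC, of "{v}" "{v'}"] dv by (simp add: C'_def)
  then have "bij_betw \<delta> (A \<union> insert v C) (A' \<union> insert v' C')"
    by (rule bij_betw_combine[OF dA]) (use A' in \<open>auto simp: C'_def\<close>)
  then have "bij_betw \<delta> S S" by (simp only: S(1,2)[symmetric])
  moreover have "bij_betw \<delta> (insert d X) (insert d X)"
  proof -
    have "id i = \<delta> i" if "i \<in> insert d X" for i
    proof -
      have "i \<notin> S" using that V(3,4) by auto
      then show ?thesis by (simp add: out)
    qed
    then show ?thesis
      using bij_betw_cong[of "insert d X" id \<delta> "insert d X"] bij_betw_id by blast
  qed
  ultimately have "bij_betw \<delta> (S \<union> insert d X) (S \<union> insert d X)"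
    by (rule bij_betw_combine) (use V in auto)
  moreover have "S \<union> insert d X = {1..d}" using V by auto
  ultimately have bij: "bij_betw \<delta> {1..d} {1..d}" by simp
  have "\<delta> ` B = B" if "B \<in> R" for B
  proof -
    have "B \<inter> S = {}" using that V by blast
    then show ?thesis using out by force
  qed
  then have R: "(`) \<delta> ` R = R" by simp
  have "(`) \<delta> ` peak_blocks R S d A v = peak_blocks R S d A' v'"
    using bij_betw_imp_surj_on[OF dA] bij_betw_imp_surj_on[OF dC] dv out[OF V(4)]
    unfolding peak_blocks_def C_def[symmetric] C'_def[symmetric] unfolding S(3,4) by (simp add: image_Un R)
  moreover have "\<Union>(peak_blocks R S d A v) \<subseteq> {1..d}"
    using A V by (auto simp: peak_blocks_def)
  ultimately show ?thesis
    using nu_e_series_relabel[OF _ bij out[OF V(4)] V(5)] by metis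
qed

text \<open>N - l is the size of \<open>S - L\<close>; for l = N this side is empty and gives no
  part. The second component counts L together with d.\<close>

definition extended_type :: "nat multiset \<Rightarrow> nat \<Rightarrow> nat \<Rightarrow> nat multiset \<times> nat" where
  "extended_type ls N l = (ls + (if l = N then {#} else {#N - l#}), l + 1)"

lemma nu_split_blocks:
  assumes V: "{1..d} = X \<union> insert d S" "d \<notin> X" "X \<inter> S = {}" "d \<notin> S" "partition_on X R"
    and L: "L \<subseteq> S"
  shows "Poly_Mapping.lookup (nu d (e_series d (R \<union> {insert d L, S - L}))) t =
    of_bool (extended_type (image_mset card (mset_set R)) (card S) (card L) = t)"
proof -
  \<comment> \<open>For L = S the empty set is dropped: it is no block of a partition, and it
    imposes nothing on a colouring.\<close>
  define \<pi> where "\<pi> = insert (insert d L) (R \<union> ({S - L} - {{}}))"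
  have fin: "finite S" "finite X"
    using finite_subset[of S "{1..d}"] finite_subset[of X "{1..d}"] V(1) by auto
  then have finR: "finite R" using V(5) finite_elements by blast
  have RX: "B \<subseteq> X" "B \<noteq> {}" if "B \<in> R" for B
    using that partition_onD1[OF V(5)] partition_onD3[OF V(5)] by auto
  have disj: "disjnt B (S - L)" "disjnt B (insert d L)" if "B \<in> R" for B
    using RX[OF that] V L by (auto simp: disjnt_def)
  have "partition_on {1..d} \<pi>"
  proof (rule partition_onI)
    show "\<Union>\<pi> = {1..d}"
      using partition_onD1[OF V(5)] V(1) L by (auto simp: \<pi>_def)
    show "{} \<notin> \<pi>" using RX by (auto simp: \<pi>_def)
    show "disjnt p q" if "p \<in> \<pi>" "q \<in> \<pi>" "p \<noteq> q" for p q
    proof -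
      have "disjnt (S - L) (insert d L)" using V L by (auto simp: disjnt_def)
      moreover have "disjnt p q" if "p \<in> R" "q \<in> R"
        using that \<open>p \<noteq> q\<close> partition_onD2[OF V(5)] by (auto simp: pairwise_def)
      ultimately show ?thesis
        using that disj by (auto simp: \<pi>_def disjnt_sym)
    qed
  qed
  then have \<pi>: "\<pi> \<in> set_partitions d" by (simp add: set_partitions_def)
  have "e_series d (R \<union> {insert d L, S - L}) = nc_e d \<pi>"
    unfolding nc_e_eq[OF \<pi>] e_series_def
    by (intro arg_cong[where f = "colour_series d"] ext) (auto simp: injective_on_blocks_def \<pi>_def)
  moreover have "partition_type d \<pi> = extended_type (image_mset card (mset_set R)) (card S) (card L)"
  proof -
    have "insert d L \<notin> R" "S - L \<noteq> insert d L"
      using RX V by auto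
    then have rest: "\<pi> - {insert d L} = R \<union> ({S - L} - {{}})" by (auto simp: \<pi>_def)
    have "partition_type d \<pi> = (image_mset card (mset_set (R \<union> ({S - L} - {{}}))), card (insert d L))"
      unfolding rest[symmetric] by (rule partition_type_eq[OF \<pi>]) (auto simp: \<pi>_def)
    moreover have "card (insert d L) = card L + 1"
      using finite_subset[OF L fin(1)] L V(4) by (subst card_insert_disjoint) auto
    moreover have "image_mset card (mset_set (R \<union> ({S - L} - {{}}))) =
        image_mset card (mset_set R) + (if card L = card S then {#} else {#card S - card L#})"
    proof (cases "S - L = {}")
      case True
      then have "L = S" using L by auto
      then show ?thesis by simp
    next
      case False
      \<comment> \<open>The union is one of sets, so a new part appears only because
        \<open>S - L\<close> is not already a block in R.\<close>
      then have "S - L \<notin> R" using disj(1)[of "S - L"] by (auto simp: disjnt_def)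
      moreover have "card (S - L) = card S - card L" "card L \<noteq> card S"
        using L fin False by (auto simp: card_Diff_subset finite_subset dest: card_subset_eq)
      ultimately show ?thesis using False finR by simp
    qed
    ultimately show ?thesis by (simp add: extended_type_def)
  qed
  ultimately show ?thesis
    using lookup_nu_nc_e[OF \<pi>] by simp
qed

text \<open>The coefficient of \<open>e\<^sub>t\<close> in \<open>\<nu>(Y)\<close> for the graph obtained by appending \<open>TP\<^bsub>n+1\<^esub>\<close> to disjoint cliques
  of type \<open>s\<close>; the denominator is the number of configurations, which is positive for \<open>n \<ge> 1\<close>.\<close>

definition appended_coeff :: "nat \<Rightarrow> nat multiset \<times> nat \<Rightarrow> nat multiset \<times> nat \<Rightarrow> rat" where
  "appended_coeff n s t = (case s of (ls, b) \<Rightarrow> let a = b - 1; N = a + n in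
     (\<Sum>l\<le>N. of_nat (N choose l) * (of_int (weight a n l) * of_bool (extended_type ls N l = t))) /
       of_nat (N * (N - 1 choose a)))"

lemma appended_coeff_nonneg: "appended_coeff n s t \<ge> 0"
  unfolding appended_coeff_def Let_def
  by (auto split: prod.split intro!: divide_nonneg_nonneg sum_nonneg mult_nonneg_nonneg
    simp: weight_nonneg)

text \<open>All placements have the same image under \<nu>, so this image is the sum over placements
  divided by their number, and \<open>sum_peak_blocks\<close> evaluates the sum.\<close>

lemma nu_peak_blocks:
  assumes V: "{1..d} = X \<union> insert d S" "d \<notin> X" "X \<inter> S = {}" "d \<notin> S" "d \<ge> 1" "partition_on X R"
    and n: "card S = a + n" "n \<ge> 1" and Av: "(A, v) \<in> configurations S a"
  shows "Poly_Mapping.lookup (nu d (e_series d (peak_blocks R S d A v))) t =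
    appended_coeff n (image_mset card (mset_set R), a + 1) t"
proof -
  let ?K = "configurations S a" and ?\<nu> = "\<lambda>f. Poly_Mapping.lookup (nu d f) t"
  let ?ls = "image_mset card (mset_set R)"
  have R: "\<Union>R = X" using V(6) by (simp add: partition_on_def)
  have finS: "finite S" using finite_subset[of S "{1..d}"] V(1) by auto
  have "of_nat (card ?K) * ?\<nu> (e_series d (peak_blocks R S d A v)) =
      (\<Sum>p\<in>?K. 1 * ?\<nu> (e_series d (peak_blocks R S d (fst p) (snd p))))"
  proof -
    have "?\<nu> (e_series d (peak_blocks R S d (fst p) (snd p))) = ?\<nu> (e_series d (peak_blocks R S d A v))"
      if "p \<in> ?K" for p
      using nu_peak_blocks_eq[OF V(1-5) R Av, of "fst p" "snd p"] that by simp
    then show ?thesis by simp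
  qed
  also have "\<dots> = ?\<nu> (\<Sum>p\<in>?K. ncscale 1 (e_series d (peak_blocks R S d (fst p) (snd p))))"
  proof (rule lookup_nu_sum[symmetric], rule e_series_in_span)
    fix p assume "p \<in> ?K"
    then show "\<Union>(peak_blocks R S d (fst p) (snd p)) \<subseteq> {1..d}"
      unfolding V(1) peak_blocks_def using R by (auto simp: configurations_def)
  qed
  also have "\<dots> = ?\<nu> (\<Sum>L\<in>Pow S. ncscale (of_int (weight a n (card L))) (e_series d (R \<union> {insert d L, S - L})))"
    using sum_peak_blocks[OF finS V(4) n, of R] by (simp add: split_def ncscale_def)
  also have "\<dots> = (\<Sum>L\<in>Pow S. of_int (weight a n (card L)) * ?\<nu> (e_series d (R \<union> {insert d L, S - L})))"
  proof (rule lookup_nu_sum, rule e_series_in_span)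
    fix L assume "L \<in> Pow S"
    then show "\<Union>(R \<union> {insert d L, S - L}) \<subseteq> {1..d}" unfolding V(1) using R by auto
  qed
  also have "\<dots> = (\<Sum>L\<in>Pow S. of_int (weight a n (card L)) * of_bool (extended_type ?ls (card S) (card L) = t))"
    using nu_split_blocks[OF V(1-4,6)] by simp
  also have "\<dots> = (\<Sum>l\<le>card S. of_nat (card S choose l) *
      (of_int (weight a n l) * of_bool (extended_type ?ls (card S) l = t)))"
    by (rule sum_Pow_card[OF finS])
  finally have "of_nat (card ?K) * ?\<nu> (e_series d (peak_blocks R S d A v)) =
    (\<Sum>l\<le>card S. of_nat (card S choose l) *
      (of_int (weight a n l) * of_bool (extended_type ?ls (card S) l = t)))" .
  moreover have "card ?K \<noteq> 0"
    using Av finite_configurations[OF finS] by (auto simp: card_eq_0_iff)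
  ultimately have "?\<nu> (e_series d (peak_blocks R S d A v)) =
      (\<Sum>l\<le>card S. of_nat (card S choose l) *
        (of_int (weight a n l) * of_bool (extended_type ?ls (card S) l = t))) / of_nat (card ?K)"
    by (metis nonzero_mult_div_cancel_left of_nat_eq_0_iff)
  then show ?thesis
    by (simp add: appended_coeff_def Let_def n(1) card_configurations[OF finS])
qed

section \<open>Edges and colourings of the concatenation\<close>

lemma twin_peaks_subset: "twin_peaks d \<subseteq> complete_graph d"
  by (auto simp: twin_peaks_def)

lemma doubleton_in_complete_graph: "{i, j} \<in> complete_graph d \<longleftrightarrow> i \<in> {1..d} \<and> j \<in> {1..d} \<and> i \<noteq> j"
  by (auto simp: complete_graph_def doubleton_eq_iff)

lemma shifted_twin_peaks:
  assumes "g \<ge> 1"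
  shows "{i, j} \<in> (\<lambda>e. (\<lambda>i. g - 1 + i) ` e) ` twin_peaks (n + 1) \<longleftrightarrow>
    i \<in> {g..g + n} \<and> j \<in> {g..g + n} \<and> i \<noteq> j \<and> {i, j} \<noteq> {g, g + n}" (is "?l \<longleftrightarrow> ?r")
proof
  assume ?l
  then obtain e where e: "e \<in> twin_peaks (n + 1)" "{i, j} = (\<lambda>i. g - 1 + i) ` e" by blast
  then have "e \<in> complete_graph (n + 1)" "e \<noteq> {1, n + 1}" by (simp_all add: twin_peaks_def)
  then obtain p q where pq: "e = {p, q}" "p \<in> {1..n + 1}" "q \<in> {1..n + 1}" "p \<noteq> q" "{p, q} \<noteq> {1, n + 1}"
    unfolding complete_graph_def by blast
  have ne: "\<not> (p = 1 \<and> q = n + 1)" "\<not> (p = n + 1 \<and> q = 1)" using pq(5) by auto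
  have "{i, j} = {g - 1 + p, g - 1 + q}" using e(2) pq(1) by simp
  then consider "i = g - 1 + p" "j = g - 1 + q" | "i = g - 1 + q" "j = g - 1 + p"
    unfolding doubleton_eq_iff by blast
  then have "i \<in> {g..g + n} \<and> j \<in> {g..g + n} \<and> i \<noteq> j \<and> \<not> (i = g \<and> j = g + n) \<and> \<not> (i = g + n \<and> j = g)"
  proof cases
    case 1
    then show ?thesis using ne(1) ne(2) pq(2-4) assms unfolding atLeastAtMost_iff by arith
  next
    case 2
    then show ?thesis using ne(1) ne(2) pq(2-4) assms unfolding atLeastAtMost_iff by arith
  qed
  then show ?r
    unfolding doubleton_eq_iff by blast
next
  assume ?r
  define p q where "p = i - (g - 1)" and "q = j - (g - 1)"
  have pq: "i = g - 1 + p" "j = g - 1 + q" "p \<in> {1..n + 1}" "q \<in> {1..n + 1}" "p \<noteq> q" "{p, q} \<noteq> {1, n + 1}"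
    using \<open>?r\<close> assms by (auto simp: p_def q_def doubleton_eq_iff)
  then have "{p, q} \<in> twin_peaks (n + 1)"
    by (simp only: twin_peaks_def Diff_iff doubleton_in_complete_graph singleton_iff simp_thms)
  moreover have "{i, j} = (\<lambda>i. g - 1 + i) ` {p, q}" using pq by simp
  ultimately show ?l by (rule rev_image_eqI)
qed

text \<open>A complete graph without one edge is the union of two cliques, each omitting one end of
  that edge. The shift by g - 1 makes these ends g and g + n.\<close>

lemma proper_concatenation_twin_peaks:
  fixes \<kappa> :: "nat \<Rightarrow> nat"
  assumes "g \<ge> 1"
  shows "(\<forall>i j. {i, j} \<in> concatenation g E (twin_peaks (n + 1)) \<longrightarrow> \<kappa> i \<noteq> \<kappa> j) \<longleftrightarrow>
    (\<forall>i j. {i, j} \<in> E \<longrightarrow> \<kappa> i \<noteq> \<kappa> j) \<and> inj_on \<kappa> {g..<g + n} \<and> inj_on \<kappa> {g<..g + n}"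
proof -
  have "(\<forall>i j. {i, j} \<in> (\<lambda>e. (\<lambda>i. g - 1 + i) ` e) ` twin_peaks (n + 1) \<longrightarrow> \<kappa> i \<noteq> \<kappa> j) \<longleftrightarrow>
      inj_on \<kappa> {g..<g + n} \<and> inj_on \<kappa> {g<..g + n}" (is "?l \<longleftrightarrow> ?r")
  proof
    assume ?l
    then have *: "\<kappa> i \<noteq> \<kappa> j" if "i \<in> {g..g + n}" "j \<in> {g..g + n}" "i \<noteq> j" "{i, j} \<noteq> {g, g + n}" for i j
      using that unfolding shifted_twin_peaks[OF assms] by blast
    have ne: "{i, j} \<noteq> {g, g + n}" if "{i, j} \<subseteq> {g..<g + n} \<or> {i, j} \<subseteq> {g<..g + n}" for i j
      using that by (auto simp: doubleton_eq_iff)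
    have "\<kappa> i \<noteq> \<kappa> j" if "i \<noteq> j" "{i, j} \<subseteq> {g..<g + n} \<or> {i, j} \<subseteq> {g<..g + n}" for i j
    proof -
      have "i \<in> {g..g + n}" "j \<in> {g..g + n}" using that(2) by auto
      then show ?thesis by (rule *[OF _ _ that(1) ne[OF that(2)]])
    qed
    then show ?r
      unfolding inj_on_def by blast
  next
    assume r: ?r
    show ?l
      unfolding shifted_twin_peaks[OF assms]
    proof (intro allI impI)
      fix i j assume ij: "i \<in> {g..g + n} \<and> j \<in> {g..g + n} \<and> i \<noteq> j \<and> {i, j} \<noteq> {g, g + n}"
      then have "{i, j} \<subseteq> {g..<g + n} \<or> {i, j} \<subseteq> {g<..g + n}"
        by (auto simp: doubleton_eq_iff)
      with r ij show "\<kappa> i \<noteq> \<kappa> j"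
        by (meson inj_on_eq_iff insert_subset)
    qed
  qed
  then show ?thesis
    unfolding concatenation_def Un_iff by blast
qed

lemma labelled_graph_twin_peaks: "d \<ge> 1 \<Longrightarrow> labelled_graph d (twin_peaks d)"
  by (simp add: labelled_graph_def twin_peaks_subset)

lemma labelled_graph_concatenation:
  assumes "labelled_graph g E" and "labelled_graph m F"
  shows "labelled_graph (g + m - 1) (concatenation g E F)"
proof -
  have gm: "g \<ge> 1" "m \<ge> 1" using assms by (simp_all add: labelled_graph_def)
  have "E \<subseteq> complete_graph (g + m - 1)"
    using assms(1) gm unfolding labelled_graph_def complete_graph_def by fastforce
  moreover have "(\<lambda>i. g - 1 + i) ` e \<in> complete_graph (g + m - 1)" if "e \<in> F" for e
  proof -
    have "e \<in> complete_graph m" using that assms(2) by (auto simp: labelled_graph_def)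
    then obtain i j where "e = {i, j}" "i \<in> {1..m}" "j \<in> {1..m}" "i \<noteq> j"
      unfolding complete_graph_def by blast
    then have "(\<lambda>i. g - 1 + i) ` e = {g - 1 + i, g - 1 + j}" "{g - 1 + i, g - 1 + j} \<in> complete_graph (g + m - 1)"
      using gm by (auto simp: doubleton_in_complete_graph)
    then show ?thesis by simp
  qed
  ultimately show ?thesis
    using gm by (auto simp: labelled_graph_def concatenation_def)
qed

lemma partition_type_in_ub_index:
  assumes "\<pi> \<in> set_partitions d" and "d \<ge> 1"
  shows "partition_type d \<pi> \<in> ub_index d"
proof -
  have p: "partition_on {1..d} \<pi>" using assms by (simp add: set_partitions_def)
  have "d \<in> \<Union>\<pi>" using partition_onD1[OF p] assms(2) by auto
  then obtain B where B: "B \<in> \<pi>" "d \<in> B" by blast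
  have fin: "finite \<pi>" "\<And>C. C \<in> \<pi> \<Longrightarrow> finite C"
    using finite_elements[OF _ p] finite_subset[OF Union_upper[of _ \<pi>, folded partition_onD1[OF p]]] by auto
  have pos: "card C \<noteq> 0" if "C \<in> \<pi>" for C
    using fin(2)[OF that] that partition_onD3[OF p] by auto
  have "d = card (\<Union>\<pi>)" using partition_onD1[OF p, symmetric] by simp
  also have "\<dots> = (\<Sum>C\<in>\<pi>. card C)"
    using partition_onD2[OF p] fin(2) by (rule card_Union_disjoint)
  also have "\<dots> = card B + (\<Sum>C\<in>\<pi> - {B}. card C)"
    using fin(1) B(1) by (rule sum.remove)
  finally have "sum_mset (image_mset card (mset_set (\<pi> - {B}))) + card B = d"
    by (simp add: sum_unfold_sum_mset)
  moreover have "0 \<notin># image_mset card (mset_set (\<pi> - {B}))"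
  proof
    assume "0 \<in># image_mset card (mset_set (\<pi> - {B}))"
    then have "0 \<in> card ` (\<pi> - {B})"
      using fin(1) by (simp only: set_image_mset finite_set_mset_mset_set finite_Diff)
    with pos show False by force
  qed
  moreover have "card B \<ge> 1" using pos[OF B(1)] by simp
  ultimately show ?thesis
    unfolding partition_type_eq[OF assms(1) B] ub_index_def by simp
qed

text \<open>The actual concatenation is one of the placements: the gluing vertex is g, A is the rest
  of its block B, S consists of B and the vertices strictly between g and g + n, and g + n is the
  last vertex.\<close>

lemma nu_append_twin_peaks:
  assumes \<pi>: "\<pi> \<in> set_partitions g" and "g \<ge> 1" and "n \<ge> 1"
  shows "Poly_Mapping.lookup (nu (g + n) (e_series (g + n) (\<pi> \<union> {{g..<g + n}, {g<..g + n}}))) t =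
    appended_coeff n (partition_type g \<pi>) t"
proof -
  have p: "partition_on {1..g} \<pi>" using \<pi> by (simp add: set_partitions_def)
  have "g \<in> \<Union>\<pi>" using partition_onD1[OF p] \<open>g \<ge> 1\<close> by auto
  then obtain B where B: "B \<in> \<pi>" "g \<in> B" by blast
  define R X S A a where "R = \<pi> - {B}" and "X = {1..g} - B" and "S = B \<union> {g<..<g + n}"
    and "A = B - {g}" and "a = card A"
  have Bg: "B \<subseteq> {1..g}" using B(1) partition_onD1[OF p] by blast
  have finB: "finite B" using finite_subset[OF Bg] by simp
  have "disjnt B (\<Union>R)"
    using partition_onD2[OF p] B(1) by (auto simp: R_def disjoint_def disjnt_def)
  moreover have "insert B R = \<pi>" using B(1) by (auto simp: R_def)
  ultimately have R: "partition_on X R"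
    using p partition_on_insert[of B R "{1..g}"] by (simp add: X_def)
  have V: "{1..g + n} = X \<union> insert (g + n) S" "g + n \<notin> X" "X \<inter> S = {}" "g + n \<notin> S" "g + n \<ge> 1"
    using Bg assms by (auto simp: X_def S_def)
  \<comment> \<open>This is why \<open>appended_coeff\<close> recovers a from the type as b -
    1.\<close>
  have cardB: "card B = a + 1"
    using card_Suc_Diff1[OF finB B(2)] by (simp add: a_def A_def)
  have "card S = card B + card {g<..<g + n}"
    unfolding S_def using finB Bg by (intro card_Un_disjoint) auto
  then have cardS: "card S = a + n" using cardB \<open>n \<ge> 1\<close> by simp
  have Av: "(A, g) \<in> configurations S a"
    using B(2) by (auto simp: configurations_def A_def S_def a_def)
  have "S - A = {g..<g + n}" "S - A - {g} = {g<..<g + n}" "insert g A = B"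
    using B(2) Bg \<open>n \<ge> 1\<close> by (auto simp: S_def A_def)
  moreover have "insert (g + n) {g<..<g + n} = {g<..g + n}" using \<open>n \<ge> 1\<close> by auto
  moreover have "\<pi> \<union> {{g..<g + n}, {g<..g + n}} = R \<union> {B, {g..<g + n}, {g<..g + n}}"
    using B(1) by (auto simp: R_def)
  ultimately have "\<pi> \<union> {{g..<g + n}, {g<..g + n}} = peak_blocks R S (g + n) A g"
    by (simp add: peak_blocks_def)
  then show ?thesis
    using nu_peak_blocks[OF V R cardS \<open>n \<ge> 1\<close> Av]
    by (simp add: partition_type_eq[OF \<pi> B] cardB flip: R_def)
qed

text \<open>Appending multiplies every e_\<pi> in Y_G by the same factor, and after \<nu> the result
  depends on \<pi> through its type alone. Collecting equal types replaces the coefficients of Y_G,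
  whose signs are unknown, by those of y_G.\<close>

lemma chromatic_y_concatenation_twin_peaks:
  assumes "labelled_graph g E" and "n \<ge> 1"
  shows "Poly_Mapping.lookup (chromatic_y (g + n) (concatenation g E (twin_peaks (n + 1)))) t =
    (\<Sum>s\<in>partition_type g ` set_partitions g. Poly_Mapping.lookup (chromatic_y g E) s * appended_coeff n s t)"
proof -
  let ?P = "set_partitions g" and ?T = "{{g..<g + n}, {g<..g + n}}"
  have g: "g \<ge> 1" and E: "E \<subseteq> complete_graph g" using assms(1) by (simp_all add: labelled_graph_def)
  let ?proper = "\<lambda>\<kappa>. of_bool (\<forall>i j. {i, j} \<in> E \<longrightarrow> \<kappa> i \<noteq> (\<kappa> j :: nat)) :: rat"
  obtain c where c: "colour_series g ?proper = (\<Sum>\<pi>\<in>?P. ncscale (c \<pi>) (nc_e g \<pi>))"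
    using span_nc_e_expansion[OF graph_series_in_span_e[OF E]] .
  have sub: "concatenation g E (twin_peaks (n + 1)) \<subseteq> complete_graph (g + n)"
    using labelled_graph_concatenation[OF assms(1) labelled_graph_twin_peaks[of "n + 1"]]
    by (simp add: labelled_graph_def)
  have "chromatic_Y (g + n) (concatenation g E (twin_peaks (n + 1))) =
      colour_series (g + n) (\<lambda>\<kappa>. of_bool ((\<forall>i j. {i, j} \<in> E \<longrightarrow> \<kappa> i \<noteq> \<kappa> j) \<and> injective_on_blocks ?T \<kappa>))"
    unfolding chromatic_Y_eq[OF sub] proper_concatenation_twin_peaks[OF g] by (simp add: injective_on_blocks_def)
  also have "\<dots> = colour_series (g + n) (\<lambda>\<kappa>. \<Sum>\<pi>\<in>?P. c \<pi> * of_bool (injective_on_blocks (\<pi> \<union> ?T) \<kappa>))"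
  proof (rule colour_series_cong)
    fix \<kappa> :: "nat \<Rightarrow> nat" assume \<kappa>: "\<And>i. i \<in> {1..g + n} \<Longrightarrow> \<kappa> i \<ge> 1"
    have "?proper \<kappa> = (\<Sum>\<pi>\<in>?P. c \<pi> * of_bool (injective_on_blocks \<pi> \<kappa>))"
    proof (rule nc_e_expansion_pointwise[OF _ c])
      fix \<kappa> \<kappa>' :: "nat \<Rightarrow> nat" assume "\<And>i. i \<in> {1..g} \<Longrightarrow> \<kappa> i = \<kappa>' i"
      moreover have "i \<in> {1..g} \<and> j \<in> {1..g}" if "{i, j} \<in> E" for i j
        using that E doubleton_in_complete_graph by blast
      ultimately have "(\<forall>i j. {i, j} \<in> E \<longrightarrow> \<kappa> i \<noteq> \<kappa> j) = (\<forall>i j. {i, j} \<in> E \<longrightarrow> \<kappa>' i \<noteq> \<kappa>' j)"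
        by metis
      then show "?proper \<kappa> = ?proper \<kappa>'" by simp
    qed (use \<kappa> in auto)
    then have "of_bool ((\<forall>i j. {i, j} \<in> E \<longrightarrow> \<kappa> i \<noteq> \<kappa> j) \<and> injective_on_blocks ?T \<kappa>) =
        (\<Sum>\<pi>\<in>?P. c \<pi> * of_bool (injective_on_blocks \<pi> \<kappa>)) * of_bool (injective_on_blocks ?T \<kappa>)"
      unfolding of_bool_conj by simp
    also have "\<dots> = (\<Sum>\<pi>\<in>?P. c \<pi> * of_bool (injective_on_blocks (\<pi> \<union> ?T) \<kappa>))"
      unfolding injective_on_blocks_def ball_Un of_bool_conj sum_distrib_right mult.assoc ..
    finally show "of_bool ((\<forall>i j. {i, j} \<in> E \<longrightarrow> \<kappa> i \<noteq> \<kappa> j) \<and> injective_on_blocks ?T \<kappa>) =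
        (\<Sum>\<pi>\<in>?P. c \<pi> * of_bool (injective_on_blocks (\<pi> \<union> ?T) \<kappa>))" .
  qed
  also have "\<dots> = (\<Sum>\<pi>\<in>?P. ncscale (c \<pi>) (e_series (g + n) (\<pi> \<union> ?T)))"
    unfolding colour_series_sum colour_series_scale e_series_def ..
  finally have "Poly_Mapping.lookup (chromatic_y (g + n) (concatenation g E (twin_peaks (n + 1)))) t =
      Poly_Mapping.lookup (nu (g + n) (\<Sum>\<pi>\<in>?P. ncscale (c \<pi>) (e_series (g + n) (\<pi> \<union> ?T)))) t"
    unfolding chromatic_y_def by (rule arg_cong)
  also have "\<dots> = (\<Sum>\<pi>\<in>?P. c \<pi> * Poly_Mapping.lookup (nu (g + n) (e_series (g + n) (\<pi> \<union> ?T))) t)"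
  proof (rule lookup_nu_sum, rule e_series_in_span)
    fix \<pi> assume "\<pi> \<in> ?P"
    then have "\<Union>\<pi> = {1..g}" by (simp add: set_partitions_def partition_on_def)
    then show "\<Union>(\<pi> \<union> ?T) \<subseteq> {1..g + n}" using g by auto
  qed
  also have "\<dots> = (\<Sum>\<pi>\<in>?P. c \<pi> * appended_coeff n (partition_type g \<pi>) t)"
    using nu_append_twin_peaks[OF _ g assms(2)] by simp
  also have "\<dots> = (\<Sum>s\<in>partition_type g ` ?P. \<Sum>\<pi> | \<pi> \<in> ?P \<and> partition_type g \<pi> = s.
      c \<pi> * appended_coeff n (partition_type g \<pi>) t)"
    by (rule sum.image_gen[OF finite_set_partitions])
  also have "\<dots> = (\<Sum>s\<in>partition_type g ` ?P. Poly_Mapping.lookup (chromatic_y g E) s * appended_coeff n s t)"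
  proof (rule sum.cong[OF refl])
    fix s
    have "Poly_Mapping.lookup (chromatic_y g E) s = (\<Sum>\<pi>\<in>?P. c \<pi> * of_bool (partition_type g \<pi> = s))"
      unfolding chromatic_y_def chromatic_Y_eq[OF E] c by (rule lookup_nu_expansion)
    also have "\<dots> = (\<Sum>\<pi> | \<pi> \<in> ?P \<and> partition_type g \<pi> = s. c \<pi>)"
      by (rule sum.mono_neutral_cong_right) (use finite_set_partitions in auto)
    finally show "(\<Sum>\<pi> | \<pi> \<in> ?P \<and> partition_type g \<pi> = s. c \<pi> * appended_coeff n (partition_type g \<pi>) t) =
        Poly_Mapping.lookup (chromatic_y g E) s * appended_coeff n s t"
      by (simp add: sum_distrib_right)
  qed
  finally show ?thesis .
qed

theorem proposition5p4:
  fixes n :: nat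
  assumes "n \<ge> 2"
  shows "appendable_e_positive (n + 1) (twin_peaks (n + 1))"
  unfolding appendable_e_positive_def
proof (intro conjI allI impI)
  show F: "labelled_graph (n + 1) (twin_peaks (n + 1))"
    by (rule labelled_graph_twin_peaks) simp
  fix g E assume G: "e_positive g E"
  then have E: "labelled_graph g E" "g \<ge> 1" by (simp_all add: e_positive_def labelled_graph_def)
  have "Poly_Mapping.lookup (chromatic_y (g + n) (concatenation g E (twin_peaks (n + 1)))) t \<ge> 0" for t
  proof -
    \<comment> \<open>Only types of set partitions occur, and these lie in
      \<open>ub_index g\<close>, where positivity of G is assumed.\<close>
    have "Poly_Mapping.lookup (chromatic_y g E) s \<ge> 0" if "s \<in> partition_type g ` set_partitions g" for s
      using that G partition_type_in_ub_index[OF _ E(2)] by (auto simp: e_positive_def)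
    moreover have "n \<ge> 1" using assms by simp
    ultimately show ?thesis
      unfolding chromatic_y_concatenation_twin_peaks[OF E(1) \<open>n \<ge> 1\<close>]
      by (intro sum_nonneg mult_nonneg_nonneg appended_coeff_nonneg)
  qed
  then show "e_positive (g + (n + 1) - 1) (concatenation g E (twin_peaks (n + 1)))"
    using labelled_graph_concatenation[OF E(1) F] by (simp add: e_positive_def)
qed

end
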